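(* Fix $S>1$. There is a single choice of thresholds, namely a number $N^*$ (not depending on $n$) and a sequence of numbers $(L_n^* )_n$, both independent of $(\alpha,\beta)$, such that the multiscale significant-runs test with thresholds $N^*$, $L_n^*$ (defined in the context) satisfies the following. (i) For every $\alpha\in(1,2]$ and every $\beta>0$ there is a finite constant $T_*=T_*(\alpha,\beta,S)>0$ such that for each $\tau>T_*$, $$P\{\text{test rejects } \mathbf{H}_0 \mid \mathbf{H}_1(\alpha,\beta,S,\tau)\}\to 1\qquad\text{as } n\to\infty,$$ i.e. the rejection probability tends to $1$ whenever, for each $n$, the joint distribution of the data $(X_1,\dots,X_n)$ is one of those allowed by $\mathbf{H}_1(\alpha,\beta,S,\tau)$. (ii) At the same time, $$P\{\text{test rejects } \mathbf{H}_0\mid \mathbf{H}_0\}\to 0\qquad\text{as } n\to\infty.$$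
   Context: **Function classes.** For $1<\alpha\le 2$ and $\beta>0$, $\text{Hölder}(\alpha,\beta)$ is the class of functions $g:[0,1]\to[0,1]$ with continuous derivative $g'$ satisfying $|g'(x)-g'(y)|\le \alpha\beta|x-y|^{\alpha-1}$ for all $x,y\in[0,1]$. $\text{Hölder}(\alpha,\beta,S)$ is the set of $f\in\text{Hölder}(\alpha,\beta)$ with $\sup|f'|\le S$. **Hypotheses.** The data are $n$ random points $X_1,\dots,X_n\in[0,1]^2$. $\mathbf{H}_0$: the $X_i$ are i.i.d. uniform on $(0,1)^2$. $\mathbf{H}_1(\alpha,\beta,S,\tau)$: the $X_i$ are i.i.d. from the mixture $(1-\varepsilon_n)\,\mathrm{Uniform}(0,1)^2+\varepsilon_n\,\mathrm{Uniform}(\mathrm{graph}(f))$ for some $f\in\text{Hölder}(\alpha,\beta,S)$ and some $\varepsilon_n\in[0,1]$ with $\varepsilon_n>\tau\, n^{-\alpha/(1+\alpha)}$. Here $\mathrm{Uniform}(\mathrm{graph}(f))$ is the normalized arc-length measure on $\mathrm{graph}(f)=\{(x,f(x)):x\in[0,1]\}$. **Regions.** Let $J=\lceil\log_2 n\rceil$. For a scale $j\in\{0,1,\dots,J\}$ put $w=w(j)=2^{-j}$, $t=t(j)=2^{-(J-j)+1}$, $\delta_1=t/4$, $\delta_2=t/(4w)$. For integers $k,\ell_1,\ell_2$, let $R(j,k,\ell_1,\ell_2)$ be the parallelogram with vertical sides, of width $w$ and vertical thickness $t$, centered at $((k+1/2)w,\ell_1\delta_1)$ and with midline of slope $\ell_2\delta_2$: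 $$R(j,k,\ell_1,\ell_2)=\{(x,y): kw\le x\le (k+1)w,\ |y-\ell_1\delta_1-\ell_2\delta_2(x-(k+\tfrac12)w)|\le t/2\}.$$ $\mathcal{R}(j)$ is the collection of regions $R(j,k,\ell_1,\ell_2)$ with $0\le k<w^{-1}$, $0\le \ell_1\le\delta_1^{-1}$, $|\ell_2|\le\lceil S\delta_2^{-1}\rceil$. **Graphs.** $\mathcal{G}(j)=(\mathcal{V}(j),\mathcal{E}(j))$ is the directed graph with vertex set $\mathcal{V}(j)=\mathcal{R}(j)$ and with a directed edge from $R(j,k,\ell_1,\ell_2)$ to $R(j,k+1,\ell_1+\ell_2+u,\ell_2+v)$ for all integers $u,v$ with $|u|\le4$, $|v|\le 4$, whenever both regions belong to $\mathcal{R}(j)$. **Multiscale significant-runs test with thresholds $N^*$, $L_n^*$.** For each $j\in\{0,\dots,J\}$ and each $R\in\mathcal{R}(j)$, let $N(R)=\#\{i: X_i\in R\}$ and call $R$ significant if $N(R)>N^*$. A significant path in $\mathcal{G}(j)$ is a sequence $(R_1,\dots,R_m)$ of significant regions with $(R_i,R_{i+1})\in\mathcal{E}(j)$ for all $1\le i<m$; its length is $m$. Let $L_{n,j}^{\max}$ be the maximal length of a significant path in $\mathcal{G}(j)$ ($0$ if there is none) and $L_n^{\max}=\max_{0\le j\le J}L_{n,j}^{\max}$. The test rejects $\mathbf{H}_0$ if $L_n^{\max}>L_n^*$ and accepts $\mathbf{H}_0$ if $L_n^{\max}\le L_n^*$. *)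

theory Defs
  imports "HOL-Probability.Probability"
begin

section \<open>Function classes\<close>

text \<open>Functions on the unit interval are total functions of type \<^typ>\<open>real \<Rightarrow> real\<close> whose values
  outside \<open>[0,1]\<close> are irrelevant; the derivative is one-sided at the endpoints.\<close>

definition deriv01 :: "(real \<Rightarrow> real) \<Rightarrow> real \<Rightarrow> real" where
  "deriv01 g x = vector_derivative g (at x within {0..1})"

definition Holder :: "real \<Rightarrow> real \<Rightarrow> (real \<Rightarrow> real) set" where
  "Holder \<alpha> \<beta> = {g. g \<in> {0..1} \<rightarrow> {0..1} \<and> g differentiable_on {0..1} \<and>
     continuous_on {0..1} (deriv01 g) \<and>
     (\<forall>x\<in>{0..1}. \<forall>y\<in>{0..1}. \<bar>deriv01 g x - deriv01 g y\<bar> \<le> \<alpha> * \<beta> * \<bar>x - y\<bar> powr (\<alpha> - 1))}"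

definition Holder_slope :: "real \<Rightarrow> real \<Rightarrow> real \<Rightarrow> (real \<Rightarrow> real) set" where
  "Holder_slope \<alpha> \<beta> S = {f \<in> Holder \<alpha> \<beta>. \<forall>x\<in>{0..1}. \<bar>deriv01 f x\<bar> \<le> S}"

section \<open>Distributions of the data\<close>

definition graph01 :: "(real \<Rightarrow> real) \<Rightarrow> (real \<times> real) set" where
  "graph01 f = (\<lambda>x. (x, f x)) ` {0..1}"

text \<open>Arc length on the graph of a \<open>C\<^sup>1\<close> function: the image of \<open>sqrt (1 + f'(x)\<^sup>2) dx\<close> on
  \<open>[0,1]\<close> under \<open>x \<mapsto> (x, f x)\<close>.\<close>

definition arc_length_measure :: "(real \<Rightarrow> real) \<Rightarrow> (real \<times> real) measure" where
  "arc_length_measure f =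
     distr (density (restrict_space lborel {0..1}) (\<lambda>x. ennreal (sqrt (1 + (deriv01 f x)\<^sup>2))))
       borel (\<lambda>x. (x, f x))"

definition uniform_graph :: "(real \<Rightarrow> real) \<Rightarrow> (real \<times> real) measure" where
  "uniform_graph f = uniform_measure (arc_length_measure f) (graph01 f)"

definition uniform_square :: "(real \<times> real) measure" where
  "uniform_square = uniform_measure lborel ({0<..<1} \<times> {0<..<1})"

definition mixture ::
  "real \<Rightarrow> (real \<times> real) measure \<Rightarrow> (real \<times> real) measure \<Rightarrow> (real \<times> real) measure" where
  "mixture \<epsilon> M N =
     measure_of UNIV (sets borel) (\<lambda>A. ennreal (1 - \<epsilon>) * emeasure M A + ennreal \<epsilon> * emeasure N A)"

text \<open>The joint distribution of \<open>X\<^sub>1, \<dots>, X\<^sub>n\<close>; a sample point is the data set \<open>X\<close> itself, as a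
  function of the index.\<close>

definition iid_law :: "nat \<Rightarrow> (real \<times> real) measure \<Rightarrow> (nat \<Rightarrow> real \<times> real) measure" where
  "iid_law n D = PiM {1..n} (\<lambda>_. D)"

definition H0 :: "nat \<Rightarrow> (nat \<Rightarrow> real \<times> real) measure" where
  "H0 n = iid_law n uniform_square"

definition H1 ::
  "nat \<Rightarrow> real \<Rightarrow> real \<Rightarrow> real \<Rightarrow> real \<Rightarrow> (nat \<Rightarrow> real \<times> real) measure set" where
  "H1 n \<alpha> \<beta> S \<tau> = {iid_law n (mixture \<epsilon> uniform_square (uniform_graph f)) | f \<epsilon>.
     f \<in> Holder_slope \<alpha> \<beta> S \<and> \<epsilon> \<in> {0..1} \<and> \<epsilon> > \<tau> * real n powr (- \<alpha> / (1 + \<alpha>))}"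

section \<open>Regions and graphs\<close>

definition Jmax :: "nat \<Rightarrow> nat" where
  "Jmax n = nat \<lceil>log 2 (real n)\<rceil>"

definition width :: "nat \<Rightarrow> real" where
  "width j = 2 powi (- int j)"

definition thick :: "nat \<Rightarrow> nat \<Rightarrow> real" where
  "thick n j = 2 powi (- (int (Jmax n) - int j) + 1)"

definition delta1 :: "nat \<Rightarrow> nat \<Rightarrow> real" where
  "delta1 n j = thick n j / 4"

definition delta2 :: "nat \<Rightarrow> nat \<Rightarrow> real" where
  "delta2 n j = thick n j / (4 * width j)"

definition region :: "nat \<Rightarrow> nat \<Rightarrow> int \<Rightarrow> int \<Rightarrow> int \<Rightarrow> (real \<times> real) set" where
  "region n j k l1 l2 = {(x, y).
     of_int k * width j \<le> x \<and> x \<le> (of_int k + 1) * width j \<and>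
     \<bar>y - of_int l1 * delta1 n j - of_int l2 * delta2 n j * (x - (of_int k + 1/2) * width j)\<bar>
       \<le> thick n j / 2}"

definition regions :: "real \<Rightarrow> nat \<Rightarrow> nat \<Rightarrow> (real \<times> real) set set" where
  "regions S n j = {region n j k l1 l2 | k l1 l2.
     0 \<le> k \<and> of_int k < 1 / width j \<and>
     0 \<le> l1 \<and> of_int l1 \<le> 1 / delta1 n j \<and>
     \<bar>l2\<bar> \<le> \<lceil>S / delta2 n j\<rceil>}"

definition edges :: "real \<Rightarrow> nat \<Rightarrow> nat \<Rightarrow> ((real \<times> real) set \<times> (real \<times> real) set) set" where
  "edges S n j = {(region n j k l1 l2, region n j (k + 1) (l1 + l2 + u) (l2 + v)) | k l1 l2 u v.
     \<bar>u\<bar> \<le> 4 \<and> \<bar>v\<bar> \<le> 4 \<and>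
     region n j k l1 l2 \<in> regions S n j \<and>
     region n j (k + 1) (l1 + l2 + u) (l2 + v) \<in> regions S n j}"

section \<open>The multiscale significant-runs test\<close>

definition count_in :: "nat \<Rightarrow> (nat \<Rightarrow> real \<times> real) \<Rightarrow> (real \<times> real) set \<Rightarrow> nat" where
  "count_in n X R = card {i \<in> {1..n}. X i \<in> R}"

definition significant :: "nat \<Rightarrow> real \<Rightarrow> (nat \<Rightarrow> real \<times> real) \<Rightarrow> (real \<times> real) set \<Rightarrow> bool" where
  "significant n Nstar X R \<longleftrightarrow> real (count_in n X R) > Nstar"

text \<open>The empty list counts as a significant path, so that the maximal length below is \<open>0\<close> when
  no region is significant. Every edge increases the column index \<open>k\<close>, which takes finitely many
  values, so the maximum is over a finite set.\<close>

definition significant_path ::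
  "real \<Rightarrow> nat \<Rightarrow> nat \<Rightarrow> real \<Rightarrow> (nat \<Rightarrow> real \<times> real) \<Rightarrow> (real \<times> real) set list \<Rightarrow> bool" where
  "significant_path S n j Nstar X p \<longleftrightarrow>
     (\<forall>R \<in> set p. R \<in> regions S n j \<and> significant n Nstar X R) \<and>
     successively (\<lambda>R R'. (R, R') \<in> edges S n j) p"

definition Lmax_scale ::
  "real \<Rightarrow> nat \<Rightarrow> nat \<Rightarrow> real \<Rightarrow> (nat \<Rightarrow> real \<times> real) \<Rightarrow> nat" where
  "Lmax_scale S n j Nstar X = Max (length ` {p. significant_path S n j Nstar X p})"

definition Lmax :: "real \<Rightarrow> nat \<Rightarrow> real \<Rightarrow> (nat \<Rightarrow> real \<times> real) \<Rightarrow> nat" where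
  "Lmax S n Nstar X = Max ((\<lambda>j. Lmax_scale S n j Nstar X) ` {0..Jmax n})"

definition test_rejects ::
  "real \<Rightarrow> nat \<Rightarrow> real \<Rightarrow> real \<Rightarrow> (nat \<Rightarrow> real \<times> real) \<Rightarrow> bool" where
  "test_rejects S n Nstar Lstar X \<longleftrightarrow> real (Lmax S n Nstar X) > Lstar"

end

theory Submission
  imports Defs "HOL-Real_Asymp.Real_Asymp"
begin

text \<open>\<open>L\<^sub>n\<^sup>* = ln n\<close> works once \<open>N\<^sup>*\<close> is large. Under \<open>H\<^sub>0\<close> a region has mass at most
  \<open>2/n\<close> and a point meets at most two regions of a path, so Markov's inequality for
  \<open>2\<close> to the power of the total count makes a given path of length \<open>m\<close> significant with
  probability at most \<open>(e\<^sup>4 / 2 ^ N\<^sup>*)\<^sup>m\<close>. This beats the number of paths, which is polynomial in \<open>n\<close>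
  times \<open>81\<^sup>m\<close>.

  Under \<open>H\<^sub>1\<close> take the scale with \<open>2\<^sup>j \<approx> (8\<beta>n) powr (1/(1+\<alpha>))\<close>, at which the graph over a column is
  within an eighth of the thickness of its tangent. Discretizing height and slope then gives a path
  of regions covering the graph, each of mass at least a constant multiple of \<open>\<tau>/n\<close>. Cut the
  columns into blocks of length about \<open>ln n\<close>. For large \<open>\<tau>\<close> a block is fully significant
  with probability at least about \<open>n powr (-1/12)\<close>. There are at least about \<open>n powr (1/3) / ln n\<close>
  blocks, and the failures of disjoint blocks are negatively associated, so with probability tending
  to \<open>1\<close> some block is fully significant.\<close>

section \<open>Multinomial counts\<close>

definition incr :: "('c \<Rightarrow> nat) \<Rightarrow> 'c \<Rightarrow> 'c \<Rightarrow> nat" where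
  "incr v c = v(c := Suc (v c))"

lemma incr_commute: "incr (incr v c) d = incr (incr v d) c"
  by (auto simp: incr_def fun_eq_iff)

lemma incr_same [simp]: "incr v c c = Suc (v c)"
  by (simp add: incr_def)

lemma incr_other [simp]: "d \<noteq> c \<Longrightarrow> incr v c d = v d"
  by (simp add: incr_def)

locale urn =
  fixes C :: "'c set" and p :: "'c \<Rightarrow> real"
  assumes finite_C: "finite C"
    and p_nonneg: "\<And>c. c \<in> C \<Longrightarrow> 0 \<le> p c"
    and p_sum: "sum p C = 1"
begin

text \<open>\<open>E n F v\<close> is the expectation of \<open>F\<close> at the final counts when
  \<open>n\<close> independent balls are added to the counts \<open>v\<close>. Conditioning on the
  first ball, with an arbitrary start, makes the facts below plain inductions on
  \<open>n\<close>.\<close>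

primrec E :: "nat \<Rightarrow> (('c \<Rightarrow> nat) \<Rightarrow> real) \<Rightarrow> ('c \<Rightarrow> nat) \<Rightarrow> real" where
  "E 0 F v = F v"
| "E (Suc n) F v = (\<Sum>c\<in>C. p c * E n F (incr v c))"

lemma E_const: "E n (\<lambda>_. a) v = a"
  by (induction n arbitrary: v) (simp_all add: p_sum flip: sum_distrib_right)

lemma E_cmult: "E n (\<lambda>w. a * F w) v = a * E n F v"
  by (induction n arbitrary: v) (simp_all add: sum_distrib_left mult.left_commute)

lemma E_diff: "E n (\<lambda>w. F w - G w) v = E n F v - E n G v"
  by (induction n arbitrary: v) (simp_all add: sum_subtractf right_diff_distrib)

lemma E_mono: "(\<And>w. F w \<le> G w) \<Longrightarrow> E n F v \<le> E n G v"
  by (induction n arbitrary: v) (auto intro!: sum_mono mult_left_mono p_nonneg)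

lemma E_nonneg: "(\<And>w. 0 \<le> F w) \<Longrightarrow> 0 \<le> E n F v"
  by (induction n arbitrary: v) (auto intro!: sum_nonneg mult_nonneg_nonneg p_nonneg)

lemma E_incr_cong:
  "(\<And>w. F (incr w c) = F w) \<Longrightarrow> E n F (incr v c) = E n F v"
  by (induction n arbitrary: v) (simp_all add: incr_commute[of _ c])

lemma E_incr_antimono:
  "(\<And>w. F (incr w c) \<le> F w) \<Longrightarrow> E n F (incr v c) \<le> E n F v"
  by (induction n arbitrary: v)
     (auto simp: incr_commute[of _ c] intro!: sum_mono mult_left_mono p_nonneg)

lemma E_incr_mono:
  "(\<And>w. F w \<le> F (incr w c)) \<Longrightarrow> E n F v \<le> E n F (incr v c)"
  by (induction n arbitrary: v)
     (auto simp: incr_commute[of _ c] intro!: sum_mono mult_left_mono p_nonneg)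

text \<open>If every category leaves one of the two functions unchanged, then
  \<open>(F\<^sub>0 - F\<^sub>c) * (G\<^sub>0 - G\<^sub>c) = 0\<close> for the conditional expectations given that the first ball has
  category \<open>c\<close>, and averaging over \<open>c\<close> loses \<open>(F\<^sub>0 - E F) * (G\<^sub>0 - E G) \<ge> 0\<close>.\<close>

lemma negative_association:
  assumes F: "\<And>w c. c \<in> C \<Longrightarrow> F (incr w c) \<le> F w"
    and G: "\<And>w c. c \<in> C \<Longrightarrow> G (incr w c) \<le> G w"
    and disj: "\<And>c. c \<in> C \<Longrightarrow> (\<forall>w. F (incr w c) = F w) \<or> (\<forall>w. G (incr w c) = G w)"
  shows "E n (\<lambda>w. F w * G w) v \<le> E n F v * E n G v"
proof (induction n arbitrary: v)
  case (Suc n)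
  let ?F' = "E n F v" and ?G' = "E n G v"
  let ?F = "\<lambda>c. E n F (incr v c)" and ?G = "\<lambda>c. E n G (incr v c)"
  have le: "?F c \<le> ?F'" "?G c \<le> ?G'" if "c \<in> C" for c
    using F G that by (auto intro!: E_incr_antimono)
  have avg: "(\<Sum>c\<in>C. p c * h c) \<le> a" if "\<And>c. c \<in> C \<Longrightarrow> h c \<le> a" for h a
  proof -
    have "(\<Sum>c\<in>C. p c * h c) \<le> (\<Sum>c\<in>C. p c * a)"
      using that by (intro sum_mono mult_left_mono p_nonneg) auto
    then show ?thesis by (simp add: p_sum flip: sum_distrib_right)
  qed
  have eq: "?F c * ?G c = ?F' * ?G c + ?G' * ?F c - ?F' * ?G'" if "c \<in> C" for c
  proof -
    have "?F c = ?F' \<or> ?G c = ?G'"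
      using disj[OF that] E_incr_cong[of F c] E_incr_cong[of G c] by blast
    then show ?thesis by auto
  qed
  have "E (Suc n) (\<lambda>w. F w * G w) v \<le> (\<Sum>c\<in>C. p c * (?F c * ?G c))"
    using Suc.IH by (auto intro!: sum_mono mult_left_mono p_nonneg)
  also have "\<dots> = (\<Sum>c\<in>C. p c * (?F' * ?G c + ?G' * ?F c - ?F' * ?G'))"
    by (intro sum.cong refl) (simp add: eq)
  also have "\<dots> = ?F' * E (Suc n) G v + ?G' * E (Suc n) F v - ?F' * ?G'"
    by (simp add: algebra_simps sum.distrib sum_subtractf sum_distrib_left p_sum
        flip: sum_distrib_right)
  also have "\<dots> = E (Suc n) F v * E (Suc n) G v - (?F' - E (Suc n) F v) * (?G' - E (Suc n) G v)"
    by (simp only: algebra_simps)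
  also have "\<dots> \<le> E (Suc n) F v * E (Suc n) G v"
    using avg[of ?F ?F'] avg[of ?G ?G'] le by simp
  finally show ?case .
qed simp

text \<open>Blocks are peeled off one at a time. By disjointness a category in \<open>B b\<close>
  leaves the other factors unchanged, and a category outside \<open>B b\<close> leaves
  \<open>F b\<close> unchanged, so \<open>negative_association\<close> applies to \<open>F b\<close>
  and the remaining product.\<close>

lemma negative_association_prod:
  fixes B :: "'b \<Rightarrow> 'c set" and F :: "'b \<Rightarrow> ('c \<Rightarrow> nat) \<Rightarrow> real"
  assumes "finite I" and disj: "disjoint_family_on B I"
    and nonneg: "\<And>b w. 0 \<le> F b w"
    and decr: "\<And>b w c. F b (incr w c) \<le> F b w"
    and dep: "\<And>b w c. c \<notin> B b \<Longrightarrow> F b (incr w c) = F b w"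
  shows "E n (\<lambda>w. \<Prod>b\<in>I. F b w) v \<le> (\<Prod>b\<in>I. E n (F b) v)"
  using assms(1) disj
proof (induction I rule: finite_induct)
  case (insert b I)
  have "E n (\<lambda>w. F b w * (\<Prod>b\<in>I. F b w)) v \<le> E n (F b) v * E n (\<lambda>w. \<Prod>b\<in>I. F b w) v"
  proof (rule negative_association)
    fix c
    show "(\<forall>w. F b (incr w c) = F b w) \<or>
        (\<forall>w. (\<Prod>b\<in>I. F b (incr w c)) = (\<Prod>b\<in>I. F b w))"
    proof (cases "c \<in> B b")
      case True
      then have "c \<notin> B b'" if "b' \<in> I" for b'
        using insert.prems insert.hyps that by (auto simp: disjoint_family_on_def)
      then show ?thesis by (auto intro!: prod.cong dep)
    qed (auto intro: dep)
  qed (auto intro!: prod_mono decr nonneg)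
  also have "\<dots> \<le> E n (F b) v * (\<Prod>b\<in>I. E n (F b) v)"
    using insert.prems by (intro mult_left_mono insert.IH E_nonneg nonneg)
      (auto simp: disjoint_family_on_def)
  finally show ?case using insert.hyps by simp
qed (simp add: E_const)

text \<open>Counts never decrease, so a threshold met at the start stays met.\<close>

lemma E_threshold_reached:
  assumes "r \<le> v u"
  shows "E n (\<lambda>w. F w * of_bool (r \<le> w u)) v = E n F v"
  using assms
proof (induction n arbitrary: v)
  case (Suc n)
  have "r \<le> incr v c u" for c
    using Suc.prems by (cases "c = u") auto
  then show ?case by (simp add: Suc.IH)
qed simp

text \<open>Stop as soon as \<open>u\<close> has been drawn \<open>r\<close> times: the other draws, at least \<open>n - (r - v u)\<close> many,
  are unconditioned or conditioned to avoid \<open>u\<close>, and the latter only favours an increasing \<open>F\<close>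
  that ignores \<open>u\<close>.\<close>

lemma stopping_bound:
  assumes u: "u \<in> C"
    and mono: "\<And>w c. F w \<le> F (incr w c)" and dep: "\<And>w. F (incr w u) = F w"
  shows "E n (\<lambda>w. of_bool (r \<le> w u)) v * E (n - (r - v u)) F v
      \<le> E n (\<lambda>w. F w * of_bool (r \<le> w u)) v"
proof (induction n arbitrary: v)
  case (Suc n)
  let ?I = "\<lambda>w. of_bool (r \<le> w u) :: real"
  show ?case
  proof (cases "r \<le> v u")
    case True
    then show ?thesis
      using E_threshold_reached[of r v u "Suc n" "\<lambda>_. 1"] E_threshold_reached[of r v u "Suc n" F]
      by (simp only: E_const) simp
  next
    case False
    define d where "d = r - v u"
    define X where "X = E (Suc n - d) F v"
    define a where "a = E n ?I (incr v u)"
    define b where "b = E n ?I v"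
    have ab: "0 \<le> a" "0 \<le> b" unfolding a_def b_def by (intro E_nonneg; simp)+
    have split: "sum h C = h u + sum h (C - {u})" for h :: "'c \<Rightarrow> real"
      using finite_C u by (simp add: sum.remove)
    have pu: "sum p (C - {u}) = 1 - p u"
      using split[of p] p_sum by simp
    have pu0: "0 \<le> p u" "0 \<le> 1 - p u"
      using p_nonneg u pu sum_nonneg[of "C - {u}" p] by auto
    define Z where "Z = (\<Sum>c\<in>C-{u}. p c * E (n - d) F (incr v c))"
    have Fu: "E m F (incr v u) = E m F v" for m
      by (intro E_incr_cong dep)
    have Z: "(1 - p u) * E (n - d) F v \<le> Z"
    proof -
      have "(\<Sum>c\<in>C-{u}. p c * E (n - d) F v) \<le> Z"
        unfolding Z_def by (intro sum_mono mult_left_mono p_nonneg E_incr_mono mono) auto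
      then show ?thesis by (simp add: pu flip: sum_distrib_right)
    qed
    \<comment> \<open>One ordinary draw favours \<open>F\<close> no more than one draw conditioned
      to avoid \<open>u\<close>, since a ball \<open>u\<close> leaves \<open>F\<close> unchanged. If
      \<open>d > n\<close>, truncated subtraction makes \<open>Suc n - d\<close> and
      \<open>n - d\<close> both 0, and the claim is \<open>Z\<close> itself.\<close>
    have XZ: "(1 - p u) * X \<le> Z"
    proof (cases "d \<le> n")
      case True
      then have "X = p u * E (n - d) F v + Z"
        unfolding X_def Z_def by (simp add: Suc_diff_le split Fu)
      moreover have "p u * ((1 - p u) * E (n - d) F v) \<le> p u * Z"
        by (intro mult_left_mono Z pu0)
      ultimately show ?thesis by (simp add: algebra_simps)
    qed (use Z in \<open>simp add: X_def\<close>)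
    have I_other: "E n ?I (incr v c) = b" if "c \<noteq> u" for c
      unfolding b_def using that by (intro E_incr_cong) auto
    \<comment> \<open>Drawing \<open>u\<close> uses one ball and lowers the missing number by one,
      so the number of free draws is unchanged.\<close>
    have "n - (r - incr v u u) = Suc n - d"
      using False by (auto simp: d_def)
    then have step_u: "a * X \<le> E n (\<lambda>w. F w * ?I w) (incr v u)"
      using Suc.IH[of "incr v u"] by (simp add: X_def Fu a_def)
    have step_other: "b * E (n - d) F (incr v c) \<le> E n (\<lambda>w. F w * ?I w) (incr v c)"
      if "c \<noteq> u" for c
      using Suc.IH[of "incr v c"] that by (simp add: I_other d_def)
    have "E (Suc n) ?I v * X = p u * (a * X) + b * ((1 - p u) * X)"
      by (simp add: split a_def[symmetric] I_other flip: sum_distrib_right)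
         (simp add: pu algebra_simps)
    also have "\<dots> \<le> p u * (a * X) + b * Z"
      using mult_left_mono[OF XZ ab(2)] by simp
    also have "\<dots> = p u * (a * X) + (\<Sum>c\<in>C-{u}. p c * (b * E (n - d) F (incr v c)))"
      unfolding Z_def by (simp add: sum_distrib_left mult_ac)
    also have "\<dots> \<le> E (Suc n) (\<lambda>w. F w * ?I w) v"
      unfolding E.simps split
      by (intro add_mono mult_left_mono step_u sum_mono step_other p_nonneg) (use u in auto)
    finally show ?thesis unfolding X_def d_def .
  qed
qed simp

text \<open>The thresholds are imposed one after the other by \<open>stopping_bound\<close>. Each
  costs at most \<open>r\<close> draws, so a reserve of \<open>card A * r\<close> leaves at least
  \<open>n0\<close> draws for every marginal bound.\<close>

lemma joint_threshold_bound:
  assumes "finite A" "A \<subseteq> C" and \<eta>: "\<eta> \<le> 1"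
    and marg: "\<And>m u. u \<in> A \<Longrightarrow> n0 \<le> m \<Longrightarrow> 1 - \<eta> \<le> E m (\<lambda>w. of_bool (r \<le> w u)) (\<lambda>_. 0)"
    and n: "n0 + card A * r \<le> n"
  shows "(1 - \<eta>) ^ card A \<le> E n (\<lambda>w. of_bool (\<forall>u\<in>A. r \<le> w u)) (\<lambda>_. 0)"
  using assms(1,2) marg n
proof (induction A arbitrary: n rule: finite_induct)
  case empty
  then show ?case by (simp add: E_const)
next
  case (insert u A)
  let ?F = "\<lambda>w. of_bool (\<forall>u\<in>A. r \<le> w u) :: real"
  have "(1 - \<eta>) ^ card (insert u A) = (1 - \<eta>) * (1 - \<eta>) ^ card A"
    using insert.hyps by simp
  also have "\<dots> \<le> E n (\<lambda>w. of_bool (r \<le> w u)) (\<lambda>_. 0) * E (n - r) ?F (\<lambda>_. 0)"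
  proof (rule mult_mono)
    show "1 - \<eta> \<le> E n (\<lambda>w. of_bool (r \<le> w u)) (\<lambda>_. 0)"
      using insert.prems by auto
    show "(1 - \<eta>) ^ card A \<le> E (n - r) ?F (\<lambda>_. 0)"
      using insert.prems insert.hyps by (intro insert.IH) auto
  qed (use \<eta> in \<open>auto intro!: E_nonneg\<close>)
  also have "\<dots> \<le> E n (\<lambda>w. ?F w * of_bool (r \<le> w u)) (\<lambda>_. 0)"
  proof -
    have "?F (incr w u) = ?F w" for w
      using insert.hyps by (auto simp: incr_def)
    moreover have "?F w \<le> ?F (incr w c)" for w c
      by (auto simp: incr_def le_Suc_eq)
    ultimately show ?thesis
      using stopping_bound[of u ?F n r "\<lambda>_. 0"] insert.prems by simp
  qed
  also have "(\<lambda>w. ?F w * of_bool (r \<le> w u)) = (\<lambda>w. of_bool (\<forall>u\<in>insert u A. r \<le> w u))"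
    by auto
  finally show ?case .
qed

text \<open>The generating function of a binomial count at 1/2: each draw contributes the factor
  \<open>1 - p u / 2\<close>.\<close>

lemma E_half_power:
  assumes "u \<in> C"
  shows "E n (\<lambda>w. (1/2) ^ w u) v = (1/2) ^ v u * (1 - p u / 2) ^ n"
proof (induction n arbitrary: v)
  case (Suc n)
  have split: "sum h C = h u + sum h (C - {u})" for h :: "'c \<Rightarrow> real"
    using finite_C assms by (simp add: sum.remove)
  have "(\<Sum>c\<in>C-{u}. p c * ((1/2) ^ incr v c u * (1 - p u / 2) ^ n)) =
      sum p (C-{u}) * ((1/2) ^ v u * (1 - p u / 2) ^ n)"
    unfolding sum_distrib_right by (intro sum.cong) auto
  also have "sum p (C - {u}) = 1 - p u"
    using split[of p] p_sum by simp
  finally show ?case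
    by (simp add: Suc.IH split) (simp add: field_simps)
qed simp

text \<open>A Chernoff bound at base 1/2: the indicator of \<open>w u < r\<close> is at most
  \<open>2 ^ r * (1/2) ^ w u\<close>, whose mean is given by \<open>E_half_power\<close>.\<close>

lemma marginal_threshold_bound:
  assumes "u \<in> C"
  shows "1 - 2 ^ r * exp (- (p u * n / 2)) \<le> E n (\<lambda>w. of_bool (r \<le> w u)) (\<lambda>_. 0)"
proof -
  have pu: "0 \<le> p u" "p u \<le> 1"
    using assms p_nonneg p_sum member_le_sum[of u C p] finite_C by auto
  have "(1 - p u / 2) ^ n \<le> exp (- (p u / 2)) ^ n"
    using pu exp_ge_add_one_self[of "- (p u / 2)"] by (intro power_mono) auto
  also have "\<dots> = exp (- (p u * n / 2))"
    by (simp add: exp_of_nat_mult[symmetric] mult_ac)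
  finally have "1 - 2 ^ r * exp (- (p u * n / 2)) \<le> 1 - 2 ^ r * (1 - p u / 2) ^ n"
    by simp
  also have "\<dots> = E n (\<lambda>w. 1 - 2 ^ r * (1/2) ^ w u) (\<lambda>_. 0)"
    using assms by (simp add: E_diff E_cmult E_const E_half_power)
  also have "\<dots> \<le> E n (\<lambda>w. of_bool (r \<le> w u)) (\<lambda>_. 0)"
  proof (rule E_mono)
    fix w :: "'c \<Rightarrow> nat"
    have "(1::real) \<le> 2 ^ r * (1/2) ^ w u" if "w u \<le> r"
      using that by (simp add: power_one_over field_simps)
    then show "1 - 2 ^ r * (1/2) ^ w u \<le> (of_bool (r \<le> w u) :: real)"
      by (cases "r \<le> w u") auto
  qed
  finally show ?thesis .
qed

text \<open>The failure of a block is a decreasing event that depends only on its own categories, so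
  negative association bounds the joint failure by the product of the single failures. For one block
  \<open>joint_threshold_bound\<close> applies.\<close>

lemma no_full_block_bound:
  fixes B :: "'b \<Rightarrow> 'c set"
  assumes I: "finite I" "disjoint_family_on B I"
    and B: "\<And>b. b \<in> I \<Longrightarrow> B b \<subseteq> C" "\<And>b. b \<in> I \<Longrightarrow> card (B b) = L"
    and p: "\<And>b u. b \<in> I \<Longrightarrow> u \<in> B b \<Longrightarrow> q \<le> p u"
    and \<eta>: "2 ^ r * exp (- (q * n0 / 2)) \<le> \<eta>" "\<eta> \<le> 1"
    and n: "n0 + L * r \<le> n"
  shows "E n (\<lambda>w. of_bool (\<forall>b\<in>I. \<exists>u\<in>B b. w u < r)) (\<lambda>_. 0) \<le> (1 - (1 - \<eta>) ^ L) ^ card I"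
proof -
  let ?F = "\<lambda>b w. of_bool (b \<in> I \<and> (\<exists>u\<in>B b. w u < r)) :: real"
  have marg: "1 - \<eta> \<le> E m (\<lambda>w. of_bool (r \<le> w u)) (\<lambda>_. 0)"
    if "b \<in> I" "u \<in> B b" "n0 \<le> m" for b u m
  proof -
    have "0 < 2 ^ r * exp (- (q * n0 / 2))" by simp
    have u: "u \<in> C" using B that by auto
    have "q * n0 \<le> p u * m"
      using p[OF that(1,2)] p_nonneg[OF u] that(3)
      by (meson mult_left_mono mult_right_mono of_nat_0_le_iff of_nat_le_iff order.trans)
    then have "exp (- (p u * m / 2)) \<le> exp (- (q * n0 / 2))" by simp
    then have "2 ^ r * exp (- (p u * m / 2)) \<le> 2 ^ r * exp (- (q * n0 / 2))" by simp
    then show ?thesis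
      using marginal_threshold_bound[OF u, of r m] \<eta> by linarith
  qed
  have "E n (\<lambda>w. of_bool (\<forall>b\<in>I. \<exists>u\<in>B b. w u < r)) (\<lambda>_. 0) = E n (\<lambda>w. \<Prod>b\<in>I. ?F b w) (\<lambda>_. 0)"
  proof -
    have "of_bool (\<forall>b\<in>I. \<exists>u\<in>B b. w u < r) = (\<Prod>b\<in>I. ?F b w)" for w
      using I(1) by (induction I rule: finite_induct) (auto intro!: prod.cong)
    then show ?thesis by simp
  qed
  also have "\<dots> \<le> (\<Prod>b\<in>I. E n (?F b) (\<lambda>_. 0))"
  proof (rule negative_association_prod[where B = B, OF I])
    fix b c and w :: "'c \<Rightarrow> nat"
    have "w u \<le> incr w c u" for u by (simp add: incr_def)
    then show "?F b (incr w c) \<le> ?F b w"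
      by (auto simp: of_bool_def intro: le_less_trans)
    assume "c \<notin> B b"
    then have "incr w c u = w u" if "u \<in> B b" for u
      using that by (auto simp: incr_def)
    then show "?F b (incr w c) = ?F b w" by auto
  qed auto
  also have "\<dots> \<le> (\<Prod>b\<in>I. 1 - (1 - \<eta>) ^ L)"
  proof (rule prod_mono)
    fix b assume b: "b \<in> I"
    have "(1 - \<eta>) ^ card (B b) \<le> E n (\<lambda>w. of_bool (\<forall>u\<in>B b. r \<le> w u)) (\<lambda>_. 0)"
      using b B n marg finite_subset[OF B(1) finite_C] \<eta>
      by (intro joint_threshold_bound[where ?n0.0 = n0]) auto
    moreover have "0 \<le> E n (?F b) (\<lambda>_. 0)"
      by (intro E_nonneg) auto
    moreover have "?F b w = 1 - of_bool (\<forall>u\<in>B b. r \<le> w u)" for w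
    proof -
      have "(\<exists>u\<in>B b. w u < r) \<longleftrightarrow> \<not> (\<forall>u\<in>B b. r \<le> w u)" by (meson not_le)
      then show ?thesis using b by (simp add: of_bool_not_iff)
    qed
    ultimately show "0 \<le> E n (?F b) (\<lambda>_. 0) \<and> E n (?F b) (\<lambda>_. 0) \<le> 1 - (1 - \<eta>) ^ L"
      using b B by (simp add: E_diff E_const)
  qed
  finally show ?thesis by simp
qed

end

section \<open>From independent samples to urn draws\<close>

locale categorized_space = prob_space D for D :: "'a measure" +
  fixes cat :: "'a \<Rightarrow> 'c::countable" and C :: "'c set"
  assumes cat [measurable]: "cat \<in> measurable D (count_space UNIV)"
    and fin: "finite C" and cat_in: "\<And>x. x \<in> space D \<Longrightarrow> cat x \<in> C"
begin

definition weight :: "'c \<Rightarrow> real" where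
  "weight c = measure D {x \<in> space D. cat x = c}"

definition tally :: "'i set \<Rightarrow> ('i \<Rightarrow> 'a) \<Rightarrow> 'c \<Rightarrow> nat" where
  "tally I X c = card {i \<in> I. cat (X i) = c}"

lemma nn_integral_cat:
  fixes h :: "'c \<Rightarrow> ennreal"
  shows "(\<integral>\<^sup>+x. h (cat x) \<partial>D) = (\<Sum>c\<in>C. ennreal (weight c) * h c)"
proof -
  have "(\<integral>\<^sup>+x. h (cat x) \<partial>D) = (\<integral>\<^sup>+x. (\<Sum>c\<in>C. h c * indicator {x \<in> space D. cat x = c} x) \<partial>D)"
  proof (intro nn_integral_cong)
    fix x assume x: "x \<in> space D"
    have "(\<Sum>c\<in>C. h c * indicator {x \<in> space D. cat x = c} x) = (\<Sum>c\<in>C. if c = cat x then h c else 0)"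
      using x by (intro sum.cong) auto
    then show "h (cat x) = (\<Sum>c\<in>C. h c * indicator {x \<in> space D. cat x = c} x)"
      using fin cat_in[OF x] by (simp add: sum.delta)
  qed
  also have "\<dots> = (\<Sum>c\<in>C. h c * emeasure D {x \<in> space D. cat x = c})"
    by (subst nn_integral_sum) (auto simp: nn_integral_cmult_indicator)
  finally show ?thesis
    by (simp add: weight_def emeasure_eq_measure mult.commute)
qed

sublocale urn C weight
proof
  show "finite C" by (rule fin)
  show "0 \<le> weight c" for c by (simp add: weight_def)
  have "ennreal (sum weight C) = 1"
    using nn_integral_cat[of "\<lambda>_. 1"]
    by (simp add: emeasure_space_1 sum_ennreal weight_def)
  then show "sum weight C = 1" by simp
qed

text \<open>After composition with \<open>cat\<close> the sample lives in a finite product of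
  countable discrete spaces, where every function is measurable.\<close>

lemma measurable_tally:
  assumes "finite I"
  shows "(\<lambda>X. F (tally I X)) \<in> measurable (PiM I (\<lambda>_. D)) (count_space UNIV)"
proof -
  have "(\<lambda>X. restrict (\<lambda>i. cat (X i)) I) \<in>
      measurable (PiM I (\<lambda>_. D)) (PiM I (\<lambda>_. count_space (UNIV :: 'c set)))"
    by measurable
  then have *: "(\<lambda>X. restrict (\<lambda>i. cat (X i)) I) \<in>
      measurable (PiM I (\<lambda>_. D)) (count_space (PiE I (\<lambda>_. UNIV)))"
    using assms by (simp add: count_space_PiM_finite)
  have "tally I X = (\<lambda>c. card {i \<in> I. restrict (\<lambda>i. cat (X i)) I i = c})" for X
    unfolding tally_def by (intro ext arg_cong[where f = card]) auto
  then show ?thesis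
    using measurable_compose[OF *, of "\<lambda>g. F (\<lambda>c. card {i \<in> I. g i = c})" "count_space UNIV"]
    by simp
qed

lemma tally_insert:
  assumes "finite I" "i \<notin> I"
  shows "(\<lambda>c. v c + tally (insert i I) (X(i := y)) c) = (\<lambda>c. incr v (cat y) c + tally I X c)"
proof
  fix c
  have "{j \<in> insert i I. cat ((X(i := y)) j) = c} =
      {j \<in> I. cat (X j) = c} \<union> (if cat y = c then {i} else {})"
    using assms by auto
  moreover have "card \<dots> = card {j \<in> I. cat (X j) = c} + card (if cat y = c then {i} else {})"
    using assms by (intro card_Un_disjoint) auto
  ultimately show "v c + tally (insert i I) (X(i := y)) c = incr v (cat y) c + tally I X c"
    by (simp add: tally_def incr_def)
qed

text \<open>Integrating out one coordinate at a time by Fubini reproduces the recursion of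
  \<open>E\<close>; the start vector \<open>v\<close> carries the categories already drawn.\<close>

lemma nn_integral_tally:
  assumes "finite I" and F: "\<And>w. 0 \<le> F w"
  shows "(\<integral>\<^sup>+X. ennreal (F (\<lambda>c. v c + tally I X c)) \<partial>PiM I (\<lambda>_. D)) = ennreal (E (card I) F v)"
  using assms(1)
proof (induction I arbitrary: v rule: finite_induct)
  case empty
  show ?case by (simp add: PiM_empty tally_def nn_integral_count_space_finite)
next
  case (insert i I)
  interpret product_sigma_finite "\<lambda>_. D" by standard
  have "(\<integral>\<^sup>+X. ennreal (F (\<lambda>c. v c + tally (insert i I) X c)) \<partial>PiM (insert i I) (\<lambda>_. D)) =
      (\<integral>\<^sup>+y. \<integral>\<^sup>+X. ennreal (F (\<lambda>c. v c + tally (insert i I) (X(i := y)) c)) \<partial>PiM I (\<lambda>_. D) \<partial>D)"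
    using insert.hyps
      measurable_compose[OF measurable_tally[of "insert i I" "\<lambda>t. F (\<lambda>c. v c + t c)"],
        where g = ennreal and L = borel]
    by (intro product_nn_integral_insert_rev) auto
  also have "\<dots> = (\<integral>\<^sup>+y. ennreal (E (card I) F (incr v (cat y))) \<partial>D)"
    by (simp add: tally_insert insert.hyps insert.IH)
  also have "\<dots> = ennreal (E (card (insert i I)) F v)"
    using insert.hyps
    by (subst nn_integral_cat)
       (simp add: ennreal_mult'[symmetric] weight_def sum_ennreal E_nonneg F)
  finally show ?case .
qed

lemma measure_tally:
  assumes "finite I"
  shows "measure (PiM I (\<lambda>_. D)) {X \<in> space (PiM I (\<lambda>_. D)). Q (tally I X)} =
    E (card I) (\<lambda>w. of_bool (Q w)) (\<lambda>_. 0)"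
proof -
  let ?M = "PiM I (\<lambda>_. D)" and ?A = "{X \<in> space (PiM I (\<lambda>_. D)). Q (tally I X)}"
  have A: "?A \<in> sets ?M"
    using measurable_sets[OF measurable_tally[OF assms, of Q], of "{True}"]
    by (simp add: vimage_def Int_def conj_commute)
  have "emeasure ?M ?A = (\<integral>\<^sup>+X. ennreal (of_bool (Q (tally I X))) \<partial>?M)"
    by (subst nn_integral_indicator[symmetric, OF A]) (auto intro!: nn_integral_cong)
  also have "\<dots> = ennreal (E (card I) (\<lambda>w. of_bool (Q w)) (\<lambda>_. 0))"
    using nn_integral_tally[OF assms, of "\<lambda>w. of_bool (Q w)" "\<lambda>_. 0"] by simp
  finally show ?thesis
    by (simp add: measure_def E_nonneg)
qed

end

section \<open>Regions and paths\<close>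

lemma width_eq: "width j = 1 / 2 ^ j"
  by (simp add: width_def power_int_minus inverse_eq_divide)

lemma width_pos [simp]: "0 < width j"
  by (simp add: width_def)

lemma thick_pos [simp]: "0 < thick n j"
  by (simp add: thick_def)

lemma delta1_pos [simp]: "0 < delta1 n j"
  by (simp add: delta1_def)

lemma delta2_pos [simp]: "0 < delta2 n j"
  by (simp add: delta2_def)

lemma delta2_times_width: "delta2 n j * width j = delta1 n j"
  using width_pos[of j] by (simp add: delta1_def delta2_def less_imp_neq[symmetric])

lemma thick_eq: "thick n j = 2 * 2 ^ j / 2 ^ Jmax n"
proof -
  have "thick n j = 2 powi (int (Suc j) - int (Jmax n))"
    unfolding thick_def by (rule arg_cong[where f = "power_int 2"]) simp
  also have "\<dots> = 2 powi int (Suc j) / 2 powi int (Jmax n)"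
    by (rule power_int_diff) simp
  finally show ?thesis by (simp only: power_int_of_nat power_Suc)
qed

lemma thick_width: "thick n j * width j = 2 / 2 ^ Jmax n"
  by (simp add: thick_eq width_eq)

lemma Jmax_bounds:
  assumes "0 < n"
  shows "real n \<le> 2 ^ Jmax n" "2 ^ Jmax n \<le> 2 * real n"
proof -
  have c: "0 \<le> log 2 n" using assms by simp
  then have J: "real (Jmax n) = of_int \<lceil>log 2 n\<rceil>"
    by (simp add: Jmax_def)
  have "real n = 2 powr log 2 n" using assms by simp
  also have "\<dots> \<le> 2 powr Jmax n" unfolding J by (intro powr_mono) auto
  finally show "real n \<le> 2 ^ Jmax n" by (simp add: powr_realpow)
  have "2 powr Jmax n \<le> 2 powr (log 2 n + 1)"
    unfolding J by (intro powr_mono) (simp_all add: of_int_ceiling_le_add_one)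
  also have "\<dots> = 2 * n" using assms by (simp add: powr_add)
  finally show "2 ^ Jmax n \<le> 2 * real n" by (simp add: powr_realpow)
qed

lemma mem_region:
  "(x, y) \<in> region n j k l1 l2 \<longleftrightarrow>
     of_int k * width j \<le> x \<and> x \<le> (of_int k + 1) * width j \<and>
     \<bar>y - of_int l1 * delta1 n j - of_int l2 * delta2 n j * (x - (of_int k + 1/2) * width j)\<bar>
       \<le> thick n j / 2"
  by (simp add: region_def)

text \<open>Vertices of the graph are point sets, so counting paths requires recovering the indices
  from the set: \<open>k\<close> from the left edge, \<open>l1\<close> from the vertical section
  through the center, \<open>l2\<close> from the section at the right edge.\<close>

lemma region_inj:
  assumes eq: "region n j k l1 l2 = region n j k' l1' l2'"
  shows "k = k'" "l1 = l1'" "l2 = l2'"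
proof -
  have le: "k2 \<le> k1" if "region n j k1 a b = region n j k2 a' b'" for k1 a b k2 a' b'
  proof -
    define y where "y = of_int a * delta1 n j - of_int b * delta2 n j * (width j / 2)"
    have "(of_int k1 * width j, y) \<in> region n j k1 a b"
      using less_imp_le[OF width_pos[of j]] less_imp_le[OF thick_pos[of n j]]
      by (simp add: mem_region y_def algebra_simps)
    then have "of_int k2 * width j \<le> of_int k1 * width j"
      unfolding that mem_region by simp
    then show ?thesis by simp
  qed
  show k: "k = k'" using le[OF eq] le[OF eq[symmetric]] by simp
  have sec: "c = c'" if "\<And>y. \<bar>y - c\<bar> \<le> thick n j / 2 \<longleftrightarrow> \<bar>y - c'\<bar> \<le> thick n j / 2" for c c'
    using that[of "c + thick n j / 2"] that[of "c - thick n j / 2"] thick_pos[of n j] by linarith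
  let ?m = "(of_int k + 1/2) * width j"
  have "of_int l1 * delta1 n j = of_int l1' * delta1 n j"
  proof (rule sec)
    fix y
    have "(?m, y) \<in> region n j k l1 l2 \<longleftrightarrow> (?m, y) \<in> region n j k l1' l2'"
      using eq k by simp
    then show "\<bar>y - of_int l1 * delta1 n j\<bar> \<le> thick n j / 2 \<longleftrightarrow>
        \<bar>y - of_int l1' * delta1 n j\<bar> \<le> thick n j / 2"
      using width_pos[of j] by (simp add: mem_region)
  qed
  then show l1: "l1 = l1'"
    using delta1_pos[of n j] by simp
  let ?r = "(of_int k + 1) * width j"
  have "of_int l1 * delta1 n j + of_int l2 * delta2 n j * (width j / 2) =
      of_int l1 * delta1 n j + of_int l2' * delta2 n j * (width j / 2)"
  proof (rule sec)
    fix y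
    have r: "?r - ?m = width j / 2" by (simp add: algebra_simps)
    have "of_int k * width j \<le> ?r" using less_imp_le[OF width_pos[of j]] by (simp add: algebra_simps)
    moreover have "(?r, y) \<in> region n j k l1 l2 \<longleftrightarrow> (?r, y) \<in> region n j k l1 l2'"
      using eq k l1 by simp
    ultimately show "\<bar>y - (of_int l1 * delta1 n j + of_int l2 * delta2 n j * (width j / 2))\<bar> \<le> thick n j / 2 \<longleftrightarrow>
        \<bar>y - (of_int l1 * delta1 n j + of_int l2' * delta2 n j * (width j / 2))\<bar> \<le> thick n j / 2"
      unfolding mem_region r by (simp add: diff_diff_add)
  qed
  then show "l2 = l2'"
    using delta2_pos[of n j] width_pos[of j] by simp
qed

lemma region_eq_iff: "region n j k l1 l2 = region n j k' l1' l2' \<longleftrightarrow> k = k' \<and> l1 = l1' \<and> l2 = l2'"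
  by (auto dest: region_inj)

lemma closed_region: "closed (region n j k l1 l2)"
proof -
  have "region n j k l1 l2 = {z. of_int k * width j \<le> fst z} \<inter> {z. fst z \<le> (of_int k + 1) * width j} \<inter>
     {z. \<bar>snd z - of_int l1 * delta1 n j - of_int l2 * delta2 n j * (fst z - (of_int k + 1/2) * width j)\<bar>
       \<le> thick n j / 2}"
    by (auto simp: region_def)
  also have "closed \<dots>"
    by (intro closed_Int closed_Collect_le continuous_intros)
  finally show ?thesis .
qed

section \<open>Index triples and codes of paths\<close>

definition region_idx :: "real \<Rightarrow> nat \<Rightarrow> nat \<Rightarrow> (int \<times> int \<times> int) set" where
  "region_idx S n j = {0..<2 ^ j} \<times> {0..\<lfloor>1 / delta1 n j\<rfloor>} \<times> {-\<lceil>S / delta2 n j\<rceil>..\<lceil>S / delta2 n j\<rceil>}"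

lemma regions_eq: "regions S n j = (\<lambda>(k, l1, l2). region n j k l1 l2) ` region_idx S n j"
proof -
  have k: "of_int k < 1 / width j \<longleftrightarrow> k < 2 ^ j" for k
  proof -
    have "of_int k < 1 / width j \<longleftrightarrow> (of_int k :: real) < of_int (2 ^ j)"
      by (simp add: width_eq)
    then show ?thesis by (simp only: of_int_less_iff)
  qed
  have l2: "\<bar>l2\<bar> \<le> c \<longleftrightarrow> - c \<le> l2 \<and> l2 \<le> c" for l2 c :: int by auto
  show ?thesis
    unfolding regions_def region_idx_def k l2 le_floor_iff[symmetric]
    by (rule set_eqI) (simp add: image_iff Bex_def split_paired_Ex conj_ac, blast)
qed

lemma region_in_regions: "region n j k l1 l2 \<in> regions S n j \<longleftrightarrow> (k, l1, l2) \<in> region_idx S n j"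
  by (auto simp: regions_eq region_eq_iff)

lemma finite_region_idx: "finite (region_idx S n j)"
  by (simp add: region_idx_def)

lemma finite_regions: "finite (regions S n j)"
  by (simp add: regions_eq finite_region_idx)

text \<open>A path is coded by the indices of its first region and the list of its increments
  \<open>(u, v)\<close>. Each increment has 81 possible values, which is the growth rate of the
  number of paths.\<close>

fun decode_path :: "nat \<Rightarrow> nat \<Rightarrow> int \<times> int \<times> int \<Rightarrow> (int \<times> int) list \<Rightarrow> (real \<times> real) set list" where
  "decode_path n j (k, l1, l2) [] = [region n j k l1 l2]"
| "decode_path n j (k, l1, l2) ((u, v) # c) =
     region n j k l1 l2 # decode_path n j (k + 1, l1 + l2 + u, l2 + v) c"

lemma length_decode_path [simp]: "length (decode_path n j a c) = Suc (length c)"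
  by (induction n j a c rule: decode_path.induct) auto

text \<open>By injectivity of the indexing, an edge leaving the current region must be presented
  with exactly the current indices, so its increments can be read off.\<close>

lemma path_decode:
  assumes "successively (\<lambda>R R'. (R, R') \<in> edges S n j) p" "p \<noteq> []" "hd p = region n j k l1 l2"
  shows "\<exists>c. set c \<subseteq> {-4..4} \<times> {-4..4} \<and> p = decode_path n j (k, l1, l2) c"
  using assms
proof (induction p arbitrary: k l1 l2)
  case (Cons R p)
  show ?case
  proof (cases p)
    case Nil
    with Cons.prems show ?thesis by (intro exI[of _ "[]"]) simp
  next
    case (Cons R' p')
    with Cons.prems have "(region n j k l1 l2, R') \<in> edges S n j"
      by simp
    then obtain u v where uv: "\<bar>u\<bar> \<le> 4" "\<bar>v\<bar> \<le> 4"
      and R': "R' = region n j (k + 1) (l1 + l2 + u) (l2 + v)"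
      by (auto simp: edges_def region_eq_iff)
    with Cons Cons.IH[of "k + 1" "l1 + l2 + u" "l2 + v"] Cons.prems
    obtain c where "set c \<subseteq> {-4..4} \<times> {-4..4}" "p = decode_path n j (k + 1, l1 + l2 + u, l2 + v) c"
      by auto
    with uv Cons.prems show ?thesis by (intro exI[of _ "(u, v) # c"]) auto
  qed
qed simp

lemma decode_path_bound:
  assumes "set (decode_path n j a c) \<subseteq> regions S n j"
  shows "fst a + int (length c) < 2 ^ j"
  using assms
  by (induction n j a c rule: decode_path.induct) (auto simp: region_in_regions region_idx_def)

lemma significant_path_code:
  assumes "significant_path S n j N X p" "p \<noteq> []"
  obtains a c where "a \<in> region_idx S n j" "set c \<subseteq> {-4..4} \<times> {-4..4}" "p = decode_path n j a c"
proof -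
  have "hd p \<in> regions S n j"
    using assms hd_in_set[of p] by (auto simp: significant_path_def)
  then obtain k l1 l2 where "(k, l1, l2) \<in> region_idx S n j" "hd p = region n j k l1 l2"
    by (auto simp: regions_eq)
  with path_decode[of S n j p k l1 l2] assms that show thesis
    by (auto simp: significant_path_def)
qed

text \<open>The column index rises by one per step and stays below \<open>2 ^ j\<close>. This makes
  the maximum in \<open>Lmax_scale\<close> one over a finite set.\<close>

lemma significant_path_length:
  assumes "significant_path S n j N X p"
  shows "length p \<le> 2 ^ j"
proof (cases "p = []")
  case False
  with assms obtain a c where ac: "a \<in> region_idx S n j" "p = decode_path n j a c"
    by (rule significant_path_code)
  then have "fst a + int (length c) < 2 ^ j"
    using assms by (intro decode_path_bound[of _ _ _ _ S]) (auto simp: significant_path_def)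
  moreover have "0 \<le> fst a" using ac by (auto simp: region_idx_def)
  ultimately have "int (length p) \<le> int (2 ^ j)" using ac by simp
  then show ?thesis by (simp only: of_nat_le_iff)
qed simp

text \<open>Both maxima are over finite sets, and the empty path keeps the set of lengths nonempty,
  so comparing them with \<open>L\<close> amounts to exhibiting one path.\<close>

lemma test_rejects_iff:
  "test_rejects S n N L X \<longleftrightarrow> (\<exists>j\<le>Jmax n. \<exists>p. significant_path S n j N X p \<and> L < length p)"
proof -
  have Max_gr: "L < real (Max A) \<longleftrightarrow> (\<exists>a\<in>A. L < real a)" if "finite A" "A \<noteq> {}" for A
    using that Max_ge[OF that(1)] Max_in[OF that] by (meson less_le_trans of_nat_mono)
  have "finite (length ` {p. significant_path S n j N X p})" for j
    by (rule finite_subset[of _ "{..2 ^ j}"]) (auto dest: significant_path_length)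
  moreover have "significant_path S n j N X []" for j
    by (simp add: significant_path_def)
  ultimately have "L < real (Lmax_scale S n j N X) \<longleftrightarrow> (\<exists>p. significant_path S n j N X p \<and> L < length p)" for j
    unfolding Lmax_scale_def by (subst Max_gr) auto
  then show ?thesis
    unfolding test_rejects_def Lmax_def by (subst Max_gr) auto
qed

lemma sets_significant:
  assumes [measurable_cong]: "sets D = sets borel" and [measurable]: "R \<in> sets borel"
  shows "{X \<in> space (iid_law n D). significant n N X R} \<in> sets (iid_law n D)"
proof -
  have "real (count_in n X R) = (\<Sum>i\<in>{1..n}. indicator R (X i))" for X
    by (simp add: count_in_def indicator_def of_bool_def[symmetric] sum_of_bool_eq Int_def)
  then show ?thesis
    unfolding significant_def iid_law_def by simp
qed

text \<open>The graph does not depend on the data. Rejection is thus a union, over finitely many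
  scales and countably many long paths, of events that finitely many regions are
  significant.\<close>

lemma sets_test_rejects:
  assumes [measurable_cong]: "sets D = sets borel"
  shows "{X \<in> space (iid_law n D). test_rejects S n N L X} \<in> sets (iid_law n D)"
proof -
  let ?M = "iid_law n D"
  define paths where "paths j = {p. set p \<subseteq> regions S n j \<and>
    successively (\<lambda>R R'. (R, R') \<in> edges S n j) p \<and> L < length p}" for j
  have count: "{X \<in> space ?M. significant n N X R} \<in> sets ?M" if "R \<in> regions S n j" for R j
    using that by (intro sets_significant assms) (auto simp: regions_eq intro: borel_closed closed_region)
  have "{X \<in> space ?M. test_rejects S n N L X} =
      (\<Union>j\<in>{..Jmax n}. \<Union>p\<in>paths j. {X \<in> space ?M. \<forall>R\<in>set p. significant n N X R})"
    by (auto simp: test_rejects_iff significant_path_def paths_def)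
  also have "\<dots> \<in> sets ?M"
  proof (rule sets.finite_UN)
    fix j
    show "(\<Union>p\<in>paths j. {X \<in> space ?M. \<forall>R\<in>set p. significant n N X R}) \<in> sets ?M"
    proof (rule sets.countable_UN'')
    have "paths j \<subseteq> lists (regions S n j)" by (auto simp: paths_def)
    then show "countable (paths j)"
      using finite_regions by (meson countable_finite countable_lists countable_subset)
    show "{X \<in> space ?M. \<forall>R\<in>set p. significant n N X R} \<in> sets ?M" if "p \<in> paths j" for p
    proof (rule sets.sets_Collect_finite_All)
      show "{X \<in> space ?M. significant n N X R} \<in> sets ?M" if "R \<in> set p" for R
        using that \<open>p \<in> paths j\<close> count by (auto simp: paths_def)
    qed simp
    qed
  qed simp
  finally show ?thesis .
qed

section \<open>False alarms\<close>

lemma sets_uniform_square: "sets uniform_square = sets borel"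
  by (simp add: uniform_square_def)

lemma emeasure_lborel_prod_Times:
  fixes A B :: "real set"
  assumes "A \<in> sets borel" "B \<in> sets borel"
  shows "emeasure lborel (A \<times> B) = emeasure lborel A * emeasure lborel B"
proof -
  have "emeasure (lborel \<Otimes>\<^sub>M lborel) (A \<times> B) = emeasure lborel A * emeasure lborel B"
    using assms by (intro lborel.emeasure_pair_measure_Times) auto
  then show ?thesis by (simp add: lborel_prod)
qed

lemma emeasure_unit_square: "emeasure lborel ({0<..<1} \<times> {0<..<1::real} :: (real \<times> real) set) = 1"
  by (simp add: emeasure_lborel_prod_Times)

lemma prob_space_uniform_square: "prob_space uniform_square"
  unfolding uniform_square_def
  by (rule prob_space_uniform_measure) (simp_all add: emeasure_unit_square)

text \<open>Cavalieri: over its column every vertical section is an interval of length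
  \<open>thick n j\<close>, whatever the slope.\<close>

lemma emeasure_region: "emeasure lborel (region n j k l1 l2) = ennreal (width j * thick n j)"
proof -
  define c where "c x = of_int l1 * delta1 n j + of_int l2 * delta2 n j * (x - (of_int k + 1/2) * width j)" for x
  let ?I = "{of_int k * width j..(of_int k + 1) * width j}"
  have sec: "Pair x -` region n j k l1 l2 = (if x \<in> ?I then {c x - thick n j / 2..c x + thick n j / 2} else {})" for x
  proof -
    have ab: "\<bar>y - a - b\<bar> \<le> h \<longleftrightarrow> a + b - h \<le> y \<and> y \<le> a + b + h" for y a b h :: real by linarith
    show ?thesis unfolding vimage_def mem_region ab c_def by auto
  qed
  have "emeasure (lborel \<Otimes>\<^sub>M lborel) (region n j k l1 l2) =
      (\<integral>\<^sup>+x. emeasure lborel (Pair x -` region n j k l1 l2) \<partial>lborel)"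
    by (intro lborel.emeasure_pair_measure_alt)
      (simp only: lborel_prod sets_lborel borel_closed closed_region)
  also have "\<dots> = (\<integral>\<^sup>+x. ennreal (thick n j) * indicator ?I x \<partial>lborel)"
    using less_imp_le[OF thick_pos[of n j]] by (intro nn_integral_cong) (auto simp: sec)
  also have "\<dots> = ennreal (thick n j) * ennreal (width j)"
    using less_imp_le[OF width_pos[of j]]
    by (simp add: nn_integral_cmult_indicator algebra_simps)
  finally show ?thesis
    by (simp add: lborel_prod ennreal_mult'[symmetric] less_imp_le mult.commute)
qed

lemma uniform_square_region: "emeasure uniform_square (region n j k l1 l2) \<le> ennreal (width j * thick n j)"
proof -
  have "emeasure uniform_square (region n j k l1 l2) =
      emeasure lborel ({0<..<1} \<times> {0<..<1} \<inter> region n j k l1 l2)"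
    unfolding uniform_square_def
    by (subst emeasure_uniform_measure)
       (simp_all add: borel_closed closed_region borel_open open_Times emeasure_unit_square divide_ennreal_def)
  also have "\<dots> \<le> emeasure lborel (region n j k l1 l2)"
    by (intro emeasure_mono) (auto simp: borel_closed closed_region)
  finally show ?thesis by (simp add: emeasure_region)
qed

text \<open>The regions of a path lie over consecutive closed columns, and a point belongs to two of
  these only on a shared edge.\<close>

lemma decode_path_hits:
  "length (filter (\<lambda>R. z \<in> R) (decode_path n j a c)) \<le> 2"
proof -
  have step: "of_int k * width j < (of_int k + 1) * width j" for k
    by (simp add: distrib_right)
  have left: "z \<notin> region n j k l1 l2" if "fst z < of_int k * width j" for k l1 l2
    using that by (cases z) (simp add: mem_region)
  have right: "fst z \<le> (of_int k + 1) * width j" if "z \<in> region n j k l1 l2" for k l1 l2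
    using that by (cases z) (simp add: mem_region)
  have 0: "length (filter (\<lambda>R. z \<in> R) (decode_path n j (k, l1, l2) c)) = 0"
    if "fst z < of_int k * width j" for k l1 l2 c
    using that
  proof (induction c arbitrary: k l1 l2)
    case (Cons uv c)
    have "fst z < of_int (k + 1) * width j"
      using less_trans[OF Cons.prems step] by simp
    with Cons left show ?case by (cases uv) simp
  qed (simp add: left)
  \<comment> \<open>All columns after the first start strictly to the right of \<open>z\<close>, so
    only the first region can contain it.\<close>
  have 1: "length (filter (\<lambda>R. z \<in> R) (decode_path n j (k, l1, l2) c)) \<le> 1"
    if "fst z \<le> of_int k * width j" for k l1 l2 c
  proof (cases c)
    case (Cons uv c')
    have "fst z < of_int (k + 1) * width j"
      using le_less_trans[OF that step] by simp
    with 0 Cons show ?thesis by (cases uv) simp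
  qed simp
  show "length (filter (\<lambda>R. z \<in> R) (decode_path n j a c)) \<le> 2"
  proof (induction c arbitrary: a)
    case (Cons uv c)
    obtain k l1 l2 u v where [simp]: "a = (k, l1, l2)" "uv = (u, v)" by (metis prod_cases3 surj_pair)
    show ?case
    proof (cases "z \<in> region n j k l1 l2")
      case True
      then have "fst z \<le> of_int (k + 1) * width j" using right by simp
      with True 1 show ?thesis by simp
    next
      case False
      with Cons show ?thesis by simp
    qed
  next
    case Nil
    show ?case by (cases a) simp
  qed
qed

text \<open>Double counting of the incidences between data points and regions of the path.\<close>

lemma sum_hits:
  "(\<Sum>i\<in>{1..n}. length (filter (\<lambda>R. X i \<in> R) p)) = (\<Sum>R\<leftarrow>p. count_in n X R)"
proof (induction p)
  case (Cons R p)
  have "(\<Sum>i\<in>{1..n}. length (filter (\<lambda>R. X i \<in> R) (R # p))) =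
      (\<Sum>i\<in>{1..n}. of_bool (X i \<in> R) + length (filter (\<lambda>R. X i \<in> R) p))"
    by (intro sum.cong) auto
  also have "\<dots> = count_in n X R + (\<Sum>i\<in>{1..n}. length (filter (\<lambda>R. X i \<in> R) p))"
    by (simp add: sum.distrib count_in_def Int_def sum_of_bool_eq)
  finally show ?case by (simp only: Cons.IH list.map sum_list.Cons)
qed simp

text \<open>If all regions are significant, there are at least \<open>N * length p\<close>
  incidences. Markov's inequality for 2 to the power of their number factorizes over the independent
  points, and each factor is controlled by the mean number of hits of one point, at most
  \<open>length p * q\<close>.\<close>

lemma all_significant_bound:
  fixes N :: nat
  assumes "prob_space D" and sets_D: "sets D = sets borel"
    and p: "\<And>R. R \<in> set p \<Longrightarrow> R \<in> sets borel"
    and q: "\<And>R. R \<in> set p \<Longrightarrow> emeasure D R \<le> ennreal q" "0 \<le> q"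
    and hits: "\<And>z. length (filter (\<lambda>R. z \<in> R) p) \<le> 2"
  shows "measure (iid_law n D) {X \<in> space (iid_law n D). \<forall>R\<in>set p. significant n N X R}
     \<le> (exp (2 * n * q) / 2 ^ N) ^ length p"
proof -
  interpret D: prob_space D by fact
  interpret product_prob_space "\<lambda>_. D" by standard
  let ?M = "iid_law n D"
  let ?h = "\<lambda>z. length (filter (\<lambda>R. z \<in> R) p)"
  note sets_D [measurable_cong]
  have meas: "(\<lambda>z. length (filter (\<lambda>R. z \<in> R) p')) \<in> measurable D (count_space UNIV)"
    if "set p' \<subseteq> set p" for p' using that
  proof (induction p')
    case (Cons R p')
    then have [measurable]: "R \<in> sets borel" "(\<lambda>z. length (filter (\<lambda>R. z \<in> R) p')) \<in> measurable D (count_space UNIV)"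
      using p by auto
    have "(\<lambda>z. if z \<in> R then Suc (length (filter (\<lambda>R. z \<in> R) p')) else length (filter (\<lambda>R. z \<in> R) p'))
        \<in> measurable D (count_space UNIV)" by measurable
    then show ?case by (simp add: if_distrib[of length] cong: if_cong)
  qed simp
  have h [measurable]: "?h \<in> measurable D (count_space UNIV)" by (rule meas) simp
  have int_h: "(\<integral>\<^sup>+z. of_nat (length (filter (\<lambda>R. z \<in> R) p')) \<partial>D) \<le> ennreal (length p' * q)"
    if "set p' \<subseteq> set p" for p' using that
  proof (induction p')
    case (Cons R p')
    have [measurable]: "R \<in> sets borel" "(\<lambda>z. length (filter (\<lambda>R. z \<in> R) p')) \<in> measurable D (count_space UNIV)"
      using p meas Cons.prems by auto
    have "(\<integral>\<^sup>+z. of_nat (length (filter (\<lambda>R. z \<in> R) (R # p'))) \<partial>D) =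
        (\<integral>\<^sup>+z. indicator R z + of_nat (length (filter (\<lambda>R. z \<in> R) p')) \<partial>D)"
      by (intro nn_integral_cong) (auto simp: indicator_def)
    also have "\<dots> = emeasure D R + (\<integral>\<^sup>+z. of_nat (length (filter (\<lambda>R. z \<in> R) p')) \<partial>D)"
      by (subst nn_integral_add) (auto simp: sets_D)
    also have "\<dots> \<le> ennreal q + ennreal (length p' * q)"
      using Cons by (intro add_mono q) auto
    also have "\<dots> = ennreal (length (R # p') * q)"
      using q by (simp add: ennreal_plus[symmetric] algebra_simps del: ennreal_plus)
    finally show ?case .
  qed simp
  have "(\<integral>\<^sup>+z. 2 ^ ?h z \<partial>D) \<le> (\<integral>\<^sup>+z. 1 + 2 * of_nat (?h z) \<partial>D)"
  proof (rule nn_integral_mono)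
    fix z
    \<comment> \<open>Convexity up to two hits: the values 1, 2, 4 of the power are at most 1, 3,
      5.\<close>
    consider "?h z = 0" | "?h z = 1" | "?h z = 2" using hits[of z] by linarith
    then show "(2::ennreal) ^ ?h z \<le> 1 + 2 * of_nat (?h z)"
    proof cases
      case 2
      have "(2::ennreal) \<le> 1 + 2" by simp
      then show ?thesis unfolding 2 by simp
    next
      case 3
      have "(4::ennreal) \<le> 1 + 4" by simp
      then show ?thesis unfolding 3 by simp
    qed simp
  qed
  also have "\<dots> = 1 + 2 * (\<integral>\<^sup>+z. of_nat (?h z) \<partial>D)"
    by (subst nn_integral_add) (auto simp: nn_integral_cmult D.emeasure_space_1)
  also have "\<dots> \<le> 1 + 2 * ennreal (length p * q)"
    by (intro add_mono mult_left_mono int_h) auto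
  also have "\<dots> = ennreal (1 + 2 * length p * q)"
    using q by (simp add: ennreal_mult mult.assoc)
  also have "\<dots> \<le> ennreal (exp (2 * length p * q))"
    by (intro ennreal_leI) (metis exp_ge_add_one_self)
  finally have one: "(\<integral>\<^sup>+z. 2 ^ ?h z \<partial>D) \<le> ennreal (exp (2 * length p * q))" .
  let ?A = "{X \<in> space ?M. \<forall>R\<in>set p. significant n N X R}"
  have "emeasure ?M ?A \<le> (\<integral>\<^sup>+X. ennreal ((1/2) ^ (N * length p)) * (\<Prod>i\<in>{1..n}. 2 ^ ?h (X i)) \<partial>?M)"
  proof -
    have "emeasure ?M ?A \<le> (\<integral>\<^sup>+X. indicator ?A X \<partial>?M)"
      \<comment> \<open>Should \<open>?A\<close> fail to be measurable, its \<open>emeasure\<close>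
        is 0 by default.\<close>
      by (cases "?A \<in> sets ?M") (simp_all add: emeasure_notin_sets)
    also have "\<dots> \<le> (\<integral>\<^sup>+X. ennreal ((1/2) ^ (N * length p)) * (\<Prod>i\<in>{1..n}. 2 ^ ?h (X i)) \<partial>?M)"
    proof (intro nn_integral_mono)
      fix X
      show "indicator ?A X \<le> ennreal ((1/2) ^ (N * length p)) * (\<Prod>i\<in>{1..n}. 2 ^ ?h (X i))"
      proof (cases "X \<in> ?A")
        case True
        then have "N \<le> count_in n X R" if "R \<in> set p" for R
          using that by (fastforce simp: significant_def)
        then have "(\<Sum>R\<leftarrow>p. N) \<le> (\<Sum>R\<leftarrow>p. count_in n X R)"
          by (intro sum_list_mono)
        then have le: "N * length p \<le> (\<Sum>i\<in>{1..n}. ?h (X i))"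
          unfolding sum_hits by (simp add: sum_list_triv mult.commute)
        have "(\<Prod>i\<in>{1..n}. (2::ennreal) ^ ?h (X i)) = ennreal (2 ^ (\<Sum>i\<in>{1..n}. ?h (X i)))"
        proof -
          have "(\<Prod>i\<in>{1..n}. (2::ennreal) ^ ?h (X i)) = (\<Prod>i\<in>{1..n}. ennreal (2 ^ ?h (X i)))"
            by (intro prod.cong refl) (simp flip: ennreal_power)
          also have "\<dots> = ennreal (\<Prod>i\<in>{1..n}. 2 ^ ?h (X i))"
            by (rule prod_ennreal) simp
          finally show ?thesis by (simp add: power_sum)
        qed
        then have "ennreal ((1/2) ^ (N * length p)) * (\<Prod>i\<in>{1..n}. 2 ^ ?h (X i)) =
            ennreal ((1/2) ^ (N * length p) * 2 ^ (\<Sum>i\<in>{1..n}. ?h (X i)))"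
          by (simp add: ennreal_mult)
        also have "1 \<le> \<dots>"
          using le by (simp add: power_one_over field_simps)
        finally show ?thesis by (simp add: indicator_def)
      qed simp
    qed
    finally show ?thesis .
  qed
  also have "\<dots> = ennreal ((1/2) ^ (N * length p)) * (\<integral>\<^sup>+X. (\<Prod>i\<in>{1..n}. 2 ^ ?h (X i)) \<partial>?M)"
    unfolding iid_law_def by (intro nn_integral_cmult) measurable
  also have "(\<integral>\<^sup>+X. (\<Prod>i\<in>{1..n}. 2 ^ ?h (X i)) \<partial>?M) = (\<integral>\<^sup>+z. 2 ^ ?h z \<partial>D) ^ n"
    unfolding iid_law_def by (subst product_nn_integral_prod) auto
  also have "ennreal ((1/2) ^ (N * length p)) * (\<integral>\<^sup>+z. 2 ^ ?h z \<partial>D) ^ n \<le>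
      ennreal ((1/2) ^ (N * length p)) * ennreal (exp (2 * length p * q)) ^ n"
    by (intro mult_left_mono power_mono one) auto
  also have "\<dots> = ennreal ((exp (2 * n * q) / 2 ^ N) ^ length p)"
    by (simp add: ennreal_power ennreal_mult[symmetric] power_divide power_mult power_one_over
        field_simps exp_of_nat_mult[symmetric])
  finally show ?thesis
    by (simp add: measure_def enn2real_leI)
qed

text \<open>Since \<open>2 ^ Jmax n\<close> is at most \<open>2 * n\<close>, there are at most
  \<open>2 * n\<close> columns, \<open>5 * n\<close> heights and \<open>8 * S * n + 3\<close> slopes
  at every scale.\<close>

lemma card_region_idx:
  assumes "0 < n" "j \<le> Jmax n" "0 \<le> S"
  shows "real (card (region_idx S n j)) \<le> 10 * real n ^ 2 * (8 * S * n + 3)"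
proof -
  define K :: real where "K = 2 ^ Jmax n"
  have K: "K \<le> 2 * n" using Jmax_bounds[OF assms(1)] by (simp add: K_def)
  have K0: "0 \<le> K" by (simp add: K_def)
  have one: "(1::real) \<le> 2 ^ j" by simp
  have jK: "2 ^ j \<le> K" unfolding K_def using assms by (intro power_increasing) auto
  have "1 / delta1 n j = 2 * K / 2 ^ j" by (simp add: delta1_def thick_eq K_def)
  also have "\<dots> \<le> 2 * K / 1" using one K0 by (intro frac_le) auto
  finally have d1: "1 / delta1 n j \<le> 4 * n" using K by simp
  have "1 / delta2 n j = 2 * (K / 2 ^ j) / 2 ^ j"
    by (simp add: delta2_def thick_eq width_eq K_def field_simps)
  also have "\<dots> \<le> 2 * K / 1"
    using one K0 frac_le[of K K 1 "2 ^ j"] by (intro frac_le) auto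
  finally have "1 / delta2 n j \<le> 4 * n" using K by simp
  then have d2: "S / delta2 n j \<le> S * (4 * n)"
    using mult_left_mono[of "1 / delta2 n j" "4 * n" S] assms by simp
  have d20: "0 \<le> S / delta2 n j" using assms less_imp_le[OF delta2_pos] by simp
  have c1: "real (nat (\<lfloor>1 / delta1 n j\<rfloor> + 1)) \<le> 5 * n"
  proof -
    have "0 \<le> \<lfloor>1 / delta1 n j\<rfloor>" using less_imp_le[OF delta1_pos[of n j]] by simp
    then have "real (nat (\<lfloor>1 / delta1 n j\<rfloor> + 1)) \<le> 1 / delta1 n j + 1" by simp
    then show ?thesis using d1 assms(1) by linarith
  qed
  have c2: "real (nat (2 * \<lceil>S / delta2 n j\<rceil> + 1)) \<le> 8 * S * n + 3"
  proof -
    have "real (nat (2 * \<lceil>S / delta2 n j\<rceil> + 1)) = 2 * of_int \<lceil>S / delta2 n j\<rceil> + 1"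
      using d20 by simp
    also have "\<dots> \<le> 2 * (S / delta2 n j + 1) + 1"
      by (intro add_right_mono mult_left_mono of_int_ceiling_le_add_one) auto
    also have "\<dots> \<le> 2 * (S * (4 * n) + 1) + 1"
      by (intro add_right_mono mult_left_mono d2) auto
    finally show ?thesis by (simp add: algebra_simps)
  qed
  have "card (region_idx S n j) = 2 ^ j * (nat (\<lfloor>1 / delta1 n j\<rfloor> + 1) * nat (2 * \<lceil>S / delta2 n j\<rceil> + 1))"
    by (simp add: region_idx_def card_cartesian_product nat_power_eq algebra_simps)
  then have "real (card (region_idx S n j)) =
      2 ^ j * (real (nat (\<lfloor>1 / delta1 n j\<rfloor> + 1)) * real (nat (2 * \<lceil>S / delta2 n j\<rceil> + 1)))"
    by simp
  also have "\<dots> \<le> (2 * n) * ((5 * n) * (8 * S * n + 3))"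
    using jK K c1 c2 assms by (intro mult_mono) auto
  finally show ?thesis by (simp add: power2_eq_square algebra_simps)
qed

text \<open>A union bound over codes of paths with exactly \<open>Suc m\<close> regions, since a
  longer significant path has such a prefix. The condition on \<open>N\<close> makes 81
  continuations times the price of one region at most \<open>exp (- 6)\<close>; over more than
  \<open>ln n - 1\<close> steps and the first region this yields \<open>n\<close> to the power -6,
  against a polynomial of degree 4.\<close>

lemma false_alarm_bound:
  fixes N :: nat
  assumes n: "0 < n" and S: "0 \<le> S" and N: "81 * exp 4 / 2 ^ N \<le> exp (- 6 :: real)"
  shows "measure (H0 n) {X \<in> space (H0 n). test_rejects S n N (ln n) X}
     \<le> 20 * (8 * S * n + 3) / real n ^ 3"
proof -
  interpret U: prob_space uniform_square by (rule prob_space_uniform_square)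
  interpret PP: product_prob_space "\<lambda>_. uniform_square" "{1..n}" by standard
  interpret P: prob_space "H0 n"
    unfolding H0_def iid_law_def by (rule PP.prob_space_axioms)
  \<comment> \<open>A length above \<open>ln n\<close> means at least \<open>Suc m\<close> regions,
    hence \<open>m\<close> increments after the first region.\<close>
  define m where "m = nat \<lfloor>ln (real n)\<rfloor>"
  define codes where "codes = (SIGMA j:{..Jmax n}. region_idx S n j \<times>
     {c. set c \<subseteq> {-4..4::int} \<times> {-4..4::int} \<and> length c = m})"
  define ev where "ev p = {X \<in> space (H0 n). \<forall>R\<in>set p. significant n N X R}" for p
  have ln0: "0 \<le> ln (real n)" using n by simp
  have fin_codes: "finite codes"
    unfolding codes_def by (intro finite_SigmaI finite_region_idx finite_lists_length_eq) auto
  have steps: "card ({-4..4::int} \<times> {-4..4::int}) = 81" by (simp add: card_cartesian_product)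
  have reject: "{X \<in> space (H0 n). test_rejects S n N (ln n) X} \<subseteq>
      (\<Union>(j, a, c)\<in>codes. ev (decode_path n j a c))"
  proof
    fix X assume "X \<in> {X \<in> space (H0 n). test_rejects S n N (ln n) X}"
    then obtain j p where X: "X \<in> space (H0 n)" and j: "j \<le> Jmax n"
      and p: "significant_path S n j N X p" "ln n < length p"
      by (auto simp: test_rejects_iff)
    have len: "Suc m \<le> length p"
      using p(2) ln0 unfolding m_def by linarith
    define p' where "p' = take (Suc m) p"
    have "successively (\<lambda>R R'. (R, R') \<in> edges S n j) (p' @ drop (Suc m) p)"
      using p by (simp add: p'_def significant_path_def)
    then have p': "significant_path S n j N X p'"
      using p(1) set_take_subset[of "Suc m" p]
      by (auto simp: p'_def significant_path_def successively_append_iff simp del: append_take_drop_id)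
    have len': "length p' = Suc m" using len by (simp add: p'_def)
    then have "p' \<noteq> []" by auto
    with p' obtain a c where "a \<in> region_idx S n j" "set c \<subseteq> {-4..4} \<times> {-4..4}"
      "p' = decode_path n j a c"
      by (rule significant_path_code)
    moreover from this have "length c = m" using len' by simp
    ultimately have "(j, a, c) \<in> codes" "X \<in> ev (decode_path n j a c)"
      using X j p' by (auto simp: codes_def ev_def significant_path_def)
    then show "X \<in> (\<Union>(j, a, c)\<in>codes. ev (decode_path n j a c))" by blast
  qed
  have regions: "\<exists>k l1 l2. R = region n j k l1 l2" if "R \<in> set (decode_path n j a c)" for R j a c
    using that by (induction n j a c rule: decode_path.induct) auto
  have sets_ev: "ev (decode_path n j a c) \<in> sets (H0 n)" for j a c
    unfolding ev_def
  proof (rule sets.sets_Collect_finite_All)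
    show "{X \<in> space (H0 n). significant n N X R} \<in> sets (H0 n)"
      if "R \<in> set (decode_path n j a c)" for R
      unfolding H0_def using regions[OF that]
      by (intro sets_significant sets_uniform_square) (auto intro: borel_closed closed_region)
  qed simp
  have ev_bound: "measure (H0 n) (ev (decode_path n j a c)) \<le> (exp 4 / 2 ^ N) ^ Suc m"
    if "(j, a, c) \<in> codes" for j a c
  proof -
    \<comment> \<open>A region has area \<open>2 / 2 ^ Jmax n\<close>, at most \<open>2 / n\<close>;
      this is the source of \<open>exp 4\<close>.\<close>
    have q: "emeasure uniform_square R \<le> ennreal (2 / n)" if R: "R \<in> set (decode_path n j a c)" for R
    proof -
      obtain k l1 l2 where "R = region n j k l1 l2" using regions[OF R] by blast
      then have "emeasure uniform_square R \<le> ennreal (thick n j * width j)"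
        using uniform_square_region[of n j k l1 l2] by (simp add: mult.commute)
      also have "\<dots> \<le> ennreal (2 / n)"
        unfolding thick_width using Jmax_bounds[OF n] n by (intro ennreal_leI frac_le) auto
      finally show ?thesis .
    qed
    have "measure (H0 n) (ev (decode_path n j a c)) \<le>
        (exp (2 * real n * (2 / real n)) / 2 ^ N) ^ length (decode_path n j a c)"
      unfolding H0_def ev_def
    proof (rule all_significant_bound[OF prob_space_uniform_square sets_uniform_square _ q])
      show "R \<in> sets borel" if "R \<in> set (decode_path n j a c)" for R
        using regions[OF that] by (auto intro: borel_closed closed_region)
    qed (simp_all add: decode_path_hits)
    then show ?thesis using that n by (simp add: codes_def)
  qed
  have "real (card codes) = (\<Sum>j\<le>Jmax n. real (card (region_idx S n j)) * 81 ^ m)"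
    unfolding codes_def
    by (subst card_SigmaI)
      (auto simp: finite_region_idx finite_lists_length_eq card_cartesian_product card_lists_length_eq steps)
  also have "\<dots> \<le> (\<Sum>j\<le>Jmax n. 10 * real n ^ 2 * (8 * S * n + 3) * 81 ^ m)"
    using n S by (intro sum_mono mult_right_mono card_region_idx) auto
  also have "\<dots> = real (Suc (Jmax n)) * (10 * real n ^ 2 * (8 * S * n + 3)) * 81 ^ m"
    by simp
  \<comment> \<open>The number of scales is at most \<open>2 ^ Jmax n\<close>. Rounding
    \<open>81 ^ m\<close> up to \<open>81 ^ Suc m\<close> lets it merge with the probability bound
    for \<open>Suc m\<close> regions.\<close>
  also have "\<dots> \<le> (2 * n) * (10 * real n ^ 2 * (8 * S * n + 3)) * 81 ^ Suc m"
  proof (intro mult_mono)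
    have "Suc (Jmax n) \<le> 2 ^ Jmax n" by (simp add: Suc_leI less_exp)
    then have "real (Suc (Jmax n)) \<le> 2 ^ Jmax n"
      by (metis of_nat_le_iff of_nat_numeral of_nat_power)
    then show "real (Suc (Jmax n)) \<le> 2 * n" using Jmax_bounds[OF n] by simp
  qed (use S in auto)
  also have "\<dots> = 20 * real n ^ 3 * (8 * S * n + 3) * 81 ^ Suc m"
    by (simp add: power2_eq_square power3_eq_cube)
  finally have card: "real (card codes) \<le> 20 * real n ^ 3 * (8 * S * n + 3) * 81 ^ Suc m" .
  have "measure (H0 n) {X \<in> space (H0 n). test_rejects S n N (ln n) X} \<le>
      measure (H0 n) (\<Union>(j, a, c)\<in>codes. ev (decode_path n j a c))"
    using fin_codes sets_ev reject by (intro P.finite_measure_mono) auto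
  also have "\<dots> \<le> (\<Sum>(j, a, c)\<in>codes. measure (H0 n) (ev (decode_path n j a c)))"
    using measure_UNION_le[OF fin_codes, of "\<lambda>(j, a, c). ev (decode_path n j a c)" "H0 n"] sets_ev
    by (auto simp: case_prod_beta')
  also have "\<dots> \<le> (\<Sum>_\<in>codes. (exp 4 / 2 ^ N) ^ Suc m)"
    using ev_bound by (intro sum_mono) auto
  also have "\<dots> = real (card codes) * (exp 4 / 2 ^ N) ^ Suc m"
    by simp
  also have "\<dots> \<le> (20 * real n ^ 3 * (8 * S * n + 3) * 81 ^ Suc m) * (exp 4 / 2 ^ N) ^ Suc m"
    by (intro mult_right_mono card) auto
  also have "\<dots> = 20 * real n ^ 3 * (8 * S * n + 3) * (81 * exp 4 / 2 ^ N) ^ Suc m"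
    by (simp add: power_mult_distrib power_divide)
  also have "\<dots> \<le> 20 * real n ^ 3 * (8 * S * n + 3) * (1 / real n ^ 6)"
  proof (intro mult_left_mono)
    have "(81 * exp 4 / 2 ^ N) ^ Suc m \<le> exp (- 6 :: real) ^ Suc m"
      using N by (intro power_mono) auto
    also have "\<dots> = exp (- 6 * Suc m)" unfolding exp_of_nat_mult[symmetric] by (simp add: algebra_simps)
    also have "\<dots> \<le> exp (- 6 * ln n)"
    proof -
      have "ln (real n) \<le> Suc m" unfolding m_def using ln0 by linarith
      then show ?thesis by simp
    qed
    also have "\<dots> = 1 / n ^ 6"
      using n exp_of_nat_mult[of 6 "ln (real n)"] by (simp add: exp_minus field_simps)
    finally show "(81 * exp 4 / 2 ^ N) ^ Suc m \<le> 1 / real n ^ 6" by simp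
  qed (use S in auto)
  also have "\<dots> = 20 * (8 * S * n + 3) / real n ^ 3"
  proof -
    have "real n ^ 6 = real n ^ 3 * real n ^ 3" by (simp flip: power_add)
    then show ?thesis using n by (simp add: field_simps)
  qed
  finally show ?thesis .
qed

section \<open>Mass near the graph\<close>

text \<open>Each point is sorted by the index of the set \<open>U k\<close> containing it, and the
  indices are cut into \<open>K div L\<close> consecutive complete blocks of length
  \<open>L\<close>; then \<open>no_full_block_bound\<close> applies to the tallies.\<close>

lemma no_full_run_bound:
  fixes D :: "'a measure" and U :: "nat \<Rightarrow> 'a set" and n0 :: nat
  assumes "prob_space D" and U: "\<And>k. k < K \<Longrightarrow> U k \<in> sets D" and disj: "disjoint_family_on U {..<K}"
    and q: "\<And>k. k < K \<Longrightarrow> q \<le> measure D (U k)"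
    and \<eta>: "2 ^ r * exp (- (q * n0 / 2)) \<le> \<eta>" "\<eta> \<le> 1"
    and I: "finite I" "n0 + L * r \<le> card I"
  shows "measure (PiM I (\<lambda>_. D)) {X \<in> space (PiM I (\<lambda>_. D)).
      \<forall>b<K div L. \<exists>k\<in>{b * L..<Suc b * L}. card {i \<in> I. X i \<in> U k} < r}
    \<le> (1 - (1 - \<eta>) ^ L) ^ (K div L)"
proof -
  interpret D: prob_space D by fact
  \<comment> \<open>The leftover category \<open>K\<close> collects the points outside all
    \<open>U k\<close>; by disjointness the least index is the only one otherwise.\<close>
  define cat where "cat z = (LEAST k. k = K \<or> k < K \<and> z \<in> U k)" for z
  have cat_eq: "cat z = k \<longleftrightarrow> z \<in> U k" if "k < K" for z k
  proof
    assume "z \<in> U k"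
    show "cat z = k"
      unfolding cat_def
    proof (rule Least_equality)
      fix y assume "y = K \<or> y < K \<and> z \<in> U y"
      moreover have "U y \<inter> U k = {}" if "y < K" "y \<noteq> k"
        using disj \<open>k < K\<close> that by (auto simp: disjoint_family_on_def)
      ultimately show "k \<le> y" using \<open>z \<in> U k\<close> \<open>k < K\<close> by (cases "y = k") auto
    qed (use \<open>z \<in> U k\<close> \<open>k < K\<close> in simp)
  next
    assume "cat z = k"
    then show "z \<in> U k"
      using LeastI[of "\<lambda>k. k = K \<or> k < K \<and> z \<in> U k" K] that by (simp add: cat_def)
  qed
  interpret categorized_space D cat "{..K}"
  proof
    show "cat \<in> measurable D (count_space UNIV)"
      unfolding cat_def
    proof (rule measurable_Least)
      fix k
      show "(\<lambda>z. k = K \<or> k < K \<and> z \<in> U k) \<in> measurable D (count_space UNIV)"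
        using U[of k] by (cases "k < K") auto
    qed
    show "cat z \<in> {..K}" for z
      unfolding cat_def by (auto intro: Least_le)
  qed simp
  have full: "k < K" if "b < K div L" "k \<in> {b * L..<Suc b * L}" for b k
  proof -
    have "Suc b * L \<le> K div L * L" using that(1) by (intro mult_le_mono1) simp
    also have "\<dots> \<le> K" by simp
    finally show ?thesis using that(2) by simp
  qed
  have "measure (PiM I (\<lambda>_. D)) {X \<in> space (PiM I (\<lambda>_. D)).
      \<forall>b<K div L. \<exists>k\<in>{b * L..<Suc b * L}. card {i \<in> I. X i \<in> U k} < r} =
    measure (PiM I (\<lambda>_. D)) {X \<in> space (PiM I (\<lambda>_. D)).
      \<forall>b\<in>{..<K div L}. \<exists>k\<in>{b * L..<Suc b * L}. tally I X k < r}"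
    using full cat_eq by (intro arg_cong[where f = "measure _"]) (auto simp: tally_def)
  also have "\<dots> = E (card I) (\<lambda>w. of_bool (\<forall>b\<in>{..<K div L}. \<exists>k\<in>{b * L..<Suc b * L}. w k < r)) (\<lambda>_. 0)"
    by (rule measure_tally[OF I(1), where Q = "\<lambda>w. \<forall>b\<in>{..<K div L}. \<exists>k\<in>{b * L..<Suc b * L}. w k < r"])
  also have "\<dots> \<le> (1 - (1 - \<eta>) ^ L) ^ card {..<K div L}"
  proof (rule no_full_block_bound[OF _ _ _ _ _ \<eta>])
    show "disjoint_family_on (\<lambda>b. {b * L..<Suc b * L}) {..<K div L}"
    proof -
      have "{a * L..<Suc a * L} \<inter> {b * L..<Suc b * L} = {}" if "a < b" for a b
        using mult_le_mono1[of "Suc a" b L] that by auto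
      then show ?thesis
        unfolding disjoint_family_on_def by (metis inf_commute linorder_neqE_nat)
    qed
    show "{b * L..<Suc b * L} \<subseteq> {..K}" if "b \<in> {..<K div L}" for b
      using full[of b] that by (auto simp: less_imp_le)
    show "q \<le> weight k" if "b \<in> {..<K div L}" "k \<in> {b * L..<Suc b * L}" for b k
    proof -
      have k: "k < K" using full that by auto
      then have "{z \<in> space D. cat z = k} = U k"
        using cat_eq[OF k] sets.sets_into_space[OF U[OF k]] by auto
      then show ?thesis using q[OF k] by (simp add: weight_def)
    qed
  qed (use I in auto)
  finally show ?thesis by simp
qed

section \<open>Mixtures of distributions\<close>

lemma sets_mixture [simp]: "sets (mixture \<epsilon> M N) = sets borel"
  using sets.sigma_sets_eq[of borel] by (simp add: mixture_def)

text \<open>\<open>measure_of\<close> returns the prescribed set function only when it is a measure,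
  so positivity and countable additivity have to be checked.\<close>

lemma emeasure_mixture:
  assumes "sets M = sets borel" "sets N = sets borel" "A \<in> sets borel"
  shows "emeasure (mixture \<epsilon> M N) A = ennreal (1 - \<epsilon>) * emeasure M A + ennreal \<epsilon> * emeasure N A"
proof (rule emeasure_measure_of[OF mixture_def])
  show "positive (sets (mixture \<epsilon> M N)) (\<lambda>A. ennreal (1 - \<epsilon>) * emeasure M A + ennreal \<epsilon> * emeasure N A)"
    by (simp add: positive_def)
  show "countably_additive (sets (mixture \<epsilon> M N)) (\<lambda>A. ennreal (1 - \<epsilon>) * emeasure M A + ennreal \<epsilon> * emeasure N A)"
    by (rule countably_additiveI)
      (simp add: assms suminf_add[symmetric] suminf_emeasure subset_eq image_subset_iff)
qed (use assms in auto)

lemma prob_space_mixture: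
  assumes "prob_space M" "prob_space N" "sets M = sets borel" "sets N = sets borel" "\<epsilon> \<in> {0..1}"
  shows "prob_space (mixture \<epsilon> M N)"
proof
  interpret M: prob_space M by fact
  interpret N: prob_space N by fact
  have sp: "space M = UNIV" "space N = UNIV" "space (mixture \<epsilon> M N) = UNIV"
    using assms(3,4)[THEN sets_eq_imp_space_eq] by (auto simp: mixture_def)
  show "emeasure (mixture \<epsilon> M N) (space (mixture \<epsilon> M N)) = 1"
    using assms M.emeasure_space_1 N.emeasure_space_1
    by (simp add: emeasure_mixture sp ennreal_plus[symmetric] del: ennreal_plus)
qed

section \<open>Arc length on the graph\<close>

context
  fixes f :: "real \<Rightarrow> real" and \<alpha> \<beta> S :: real
  assumes f: "f \<in> Holder_slope \<alpha> \<beta> S"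
begin

lemma has_deriv01:
  "x \<in> {0..1} \<Longrightarrow> (f has_vector_derivative deriv01 f x) (at x within {0..1})"
  using f unfolding deriv01_def Holder_slope_def Holder_def differentiable_on_def
  by (auto simp flip: vector_derivative_works)

lemma continuous_on_f: "continuous_on {0..1} f"
  using f by (auto simp: Holder_slope_def Holder_def intro: differentiable_imp_continuous_on)

lemma measurable_graph_map:
  "(\<lambda>x. (x, f x)) \<in> borel_measurable (restrict_space lborel {0..1})"
proof -
  have "(\<lambda>x. (x, f x)) \<in> borel_measurable (restrict_space borel {0..1})"
    by (intro borel_measurable_continuous_on_restrict continuous_intros continuous_on_f)
  then show ?thesis
    by (simp cong: measurable_cong_sets add: sets_restrict_space)
qed

lemma emeasure_arc_length:
  assumes "A \<in> sets borel"
  shows "emeasure (arc_length_measure f) A =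
    (\<integral>\<^sup>+x. ennreal (sqrt (1 + (deriv01 f x)\<^sup>2)) * indicator {x \<in> {0..1}. (x, f x) \<in> A} x \<partial>lborel)"
proof -
  let ?R = "restrict_space lborel {0..1::real}" and ?d = "\<lambda>x. ennreal (sqrt (1 + (deriv01 f x)\<^sup>2))"
  have "deriv01 f \<in> borel_measurable (restrict_space borel {0..1})"
    using f by (intro borel_measurable_continuous_on_restrict) (auto simp: Holder_slope_def Holder_def)
  then have [measurable]: "deriv01 f \<in> borel_measurable ?R"
    by (simp cong: measurable_cong_sets add: sets_restrict_space)
  have d: "?d \<in> borel_measurable ?R" by measurable
  have pre: "(\<lambda>x. (x, f x)) -` A \<inter> {0..1} \<in> sets ?R"
    using measurable_sets[OF measurable_graph_map assms] by (simp add: space_restrict_space)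
  have "emeasure (arc_length_measure f) A = emeasure (density ?R ?d) ((\<lambda>x. (x, f x)) -` A \<inter> {0..1})"
    unfolding arc_length_measure_def using measurable_graph_map assms
    by (subst emeasure_distr) (auto simp: space_restrict_space)
  also have "\<dots> = (\<integral>\<^sup>+x. ?d x * indicator ((\<lambda>x. (x, f x)) -` A \<inter> {0..1}) x \<partial>?R)"
    by (rule emeasure_density[OF d pre])
  also have "\<dots> = (\<integral>\<^sup>+x. ?d x * indicator {x \<in> {0..1}. (x, f x) \<in> A} x \<partial>lborel)"
    by (subst nn_integral_restrict_space) (auto intro!: nn_integral_cong simp: indicator_def)
  finally show ?thesis .
qed

lemma sets_arc_length [simp]: "sets (arc_length_measure f) = sets borel"
  by (simp add: arc_length_measure_def)

text \<open>The arc-length density lies between 1 and \<open>sqrt (1 + S\<^sup>2)\<close>. The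
  half-open range of \<open>x\<close> suits the cells used later, which omit their right
  edge.\<close>

lemma arc_length_bounds:
  assumes A: "A \<in> sets borel" and ab: "0 \<le> a" "b \<le> 1" "a \<le> b"
    and sub: "\<And>x. a \<le> x \<Longrightarrow> x < b \<Longrightarrow> (x, f x) \<in> A"
  shows "ennreal (b - a) \<le> emeasure (arc_length_measure f) A"
    and "emeasure (arc_length_measure f) A \<le> ennreal (sqrt (1 + S\<^sup>2))"
proof -
  have "ennreal (b - a) = (\<integral>\<^sup>+x. indicator {a..<b} x \<partial>lborel)"
    using ab by simp
  also have "\<dots> \<le> (\<integral>\<^sup>+x. ennreal (sqrt (1 + (deriv01 f x)\<^sup>2)) * indicator {x \<in> {0..1}. (x, f x) \<in> A} x \<partial>lborel)"
    using ab sub by (intro nn_integral_mono) (auto simp: indicator_def)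
  finally show "ennreal (b - a) \<le> emeasure (arc_length_measure f) A"
    by (simp add: emeasure_arc_length A)
  have "emeasure (arc_length_measure f) A \<le> (\<integral>\<^sup>+x. ennreal (sqrt (1 + S\<^sup>2)) * indicator {0..1::real} x \<partial>lborel)"
    unfolding emeasure_arc_length[OF A]
  proof (rule nn_integral_mono)
    fix x :: real
    show "ennreal (sqrt (1 + (deriv01 f x)\<^sup>2)) * indicator {x \<in> {0..1}. (x, f x) \<in> A} x
        \<le> ennreal (sqrt (1 + S\<^sup>2)) * indicator {0..1} x"
    proof (cases "x \<in> {0..1}")
      case True
      then have "\<bar>deriv01 f x\<bar> \<le> \<bar>S\<bar>"
        using f by (force simp: Holder_slope_def)
      then have "(deriv01 f x)\<^sup>2 \<le> S\<^sup>2" by (simp add: abs_le_square_iff)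
      then show ?thesis using True by (auto simp: indicator_def intro!: ennreal_leI)
    qed (auto simp: indicator_def)
  qed
  then show "emeasure (arc_length_measure f) A \<le> ennreal (sqrt (1 + S\<^sup>2))"
    by (simp add: nn_integral_cmult_indicator)
qed

lemma graph01_sets: "graph01 f \<in> sets borel"
proof -
  have "compact (graph01 f)"
    unfolding graph01_def by (intro compact_continuous_image continuous_intros continuous_on_f) simp
  then show ?thesis by (simp add: borel_compact)
qed

lemma graph_mass_bounds:
  "1 \<le> emeasure (arc_length_measure f) (graph01 f)"
  "emeasure (arc_length_measure f) (graph01 f) \<le> ennreal (sqrt (1 + S\<^sup>2))"
  using arc_length_bounds[OF graph01_sets, of 0 1] by (auto simp: graph01_def)

lemma sets_uniform_graph [simp]: "sets (uniform_graph f) = sets borel"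
  by (simp add: uniform_graph_def)

lemma prob_space_uniform_graph: "prob_space (uniform_graph f)"
  unfolding uniform_graph_def
proof (rule prob_space_uniform_measure)
  show "emeasure (arc_length_measure f) (graph01 f) \<noteq> 0"
    using graph_mass_bounds(1) by force
  show "emeasure (arc_length_measure f) (graph01 f) \<noteq> \<infinity>"
    using graph_mass_bounds(2) by (auto simp: top_unique)
qed

text \<open>The part of the graph over \<open>[a, b)\<close> has length at least
  \<open>b - a\<close>, and the whole graph has length at most
  \<open>sqrt (1 + S\<^sup>2)\<close>.\<close>

lemma uniform_graph_strip:
  assumes A: "A \<in> sets borel" and ab: "0 \<le> a" "b \<le> 1" "a \<le> b"
    and sub: "\<And>x. a \<le> x \<Longrightarrow> x < b \<Longrightarrow> (x, f x) \<in> A"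
  shows "ennreal ((b - a) / sqrt (1 + S\<^sup>2)) \<le> emeasure (uniform_graph f) A"
proof -
  have "emeasure (arc_length_measure f) (graph01 f) \<noteq> \<top>"
    using graph_mass_bounds(2) by (auto simp: top_unique)
  then obtain G where G: "emeasure (arc_length_measure f) (graph01 f) = ennreal G" "0 \<le> G"
    by (cases "emeasure (arc_length_measure f) (graph01 f)") auto
  have "1 \<le> G"
    using graph_mass_bounds(1) G by simp
  moreover have "G \<le> sqrt (1 + S\<^sup>2)"
    using graph_mass_bounds(2) G by (simp add: ennreal_le_iff)
  ultimately have "ennreal ((b - a) / sqrt (1 + S\<^sup>2)) \<le> ennreal ((b - a) / G)"
    using ab by (intro ennreal_leI frac_le) auto
  also have "\<dots> = ennreal (b - a) / emeasure (arc_length_measure f) (graph01 f)"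
    using ab \<open>1 \<le> G\<close> by (simp add: G divide_ennreal)
  also have "\<dots> \<le> emeasure (arc_length_measure f) (graph01 f \<inter> A) / emeasure (arc_length_measure f) (graph01 f)"
    using A graph01_sets ab sub
    by (intro divide_right_mono_ennreal arc_length_bounds(1)) (auto simp: graph01_def)
  also have "\<dots> = emeasure (uniform_graph f) A"
    unfolding uniform_graph_def using A graph01_sets by simp
  finally show ?thesis .
qed

lemma mixture_strip:
  assumes M: "prob_space M" "sets M = sets borel" and \<epsilon>: "\<epsilon> \<in> {0..1}"
    and A: "A \<in> sets borel" and ab: "0 \<le> a" "b \<le> 1" "a \<le> b"
    and sub: "\<And>x. a \<le> x \<Longrightarrow> x < b \<Longrightarrow> (x, f x) \<in> A"
  shows "\<epsilon> * (b - a) / sqrt (1 + S\<^sup>2) \<le> measure (mixture \<epsilon> M (uniform_graph f)) A"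
proof -
  interpret prob_space "mixture \<epsilon> M (uniform_graph f)"
    using assms prob_space_uniform_graph by (intro prob_space_mixture) auto
  have "ennreal (\<epsilon> * (b - a) / sqrt (1 + S\<^sup>2)) = ennreal \<epsilon> * ennreal ((b - a) / sqrt (1 + S\<^sup>2))"
    using \<epsilon> ab by (simp add: ennreal_mult[symmetric])
  also have "\<dots> \<le> ennreal \<epsilon> * emeasure (uniform_graph f) A"
    using uniform_graph_strip[OF A ab sub] by (intro mult_left_mono) auto
  also have "\<dots> \<le> emeasure (mixture \<epsilon> M (uniform_graph f)) A"
    using M A by (simp add: emeasure_mixture)
  finally show ?thesis
    using \<epsilon> ab by (simp add: emeasure_eq_measure)
qed

end

section \<open>Covering the graph by a path\<close>

text \<open>The mean value inequality for \<open>f\<close> minus its tangent at \<open>c\<close>: on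
  the segment from \<open>c\<close> to \<open>x\<close> the derivative moves by at most the Holder
  bound, with the factor \<open>\<alpha>\<close> replaced by 2.\<close>

lemma linearization_bound:
  assumes f: "f \<in> Holder_slope \<alpha> \<beta> S" and \<alpha>: "1 < \<alpha>" "\<alpha> \<le> 2" and \<beta>: "0 < \<beta>"
    and xc: "x \<in> {0..1}" "c \<in> {0..1}" "\<bar>x - c\<bar> \<le> w"
  shows "\<bar>f x - f c - deriv01 f c * (x - c)\<bar> \<le> 2 * \<beta> * w powr (\<alpha> - 1) * \<bar>x - c\<bar>"
    and "\<bar>deriv01 f x - deriv01 f c\<bar> \<le> 2 * \<beta> * w powr (\<alpha> - 1)"
proof -
  have slope: "\<bar>deriv01 f y - deriv01 f c\<bar> \<le> 2 * \<beta> * w powr (\<alpha> - 1)"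
    if "y \<in> {0..1}" "\<bar>y - c\<bar> \<le> w" for y
  proof -
    have "\<bar>deriv01 f y - deriv01 f c\<bar> \<le> \<alpha> * \<beta> * \<bar>y - c\<bar> powr (\<alpha> - 1)"
      using f that xc by (auto simp: Holder_slope_def Holder_def)
    also have "\<dots> \<le> 2 * \<beta> * w powr (\<alpha> - 1)"
      using \<alpha> \<beta> that by (intro mult_mono powr_mono2) auto
    finally show ?thesis .
  qed
  show "\<bar>deriv01 f x - deriv01 f c\<bar> \<le> 2 * \<beta> * w powr (\<alpha> - 1)"
    using slope xc by blast
  have seg: "closed_segment c x \<subseteq> {0..1}"
    using xc by (auto simp: closed_segment_eq_real_ivl)
  have "norm (f x - f c - (x - c) *\<^sub>R deriv01 f c) \<le> norm (x - c) * (2 * \<beta> * w powr (\<alpha> - 1))"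
  proof (rule vector_differentiable_bound_linearization[where S = "closed_segment c x" and f' = "deriv01 f"])
    fix y assume y: "y \<in> closed_segment c x"
    then have y01: "y \<in> {0..1}" using seg by auto
    show "(f has_vector_derivative deriv01 f y) (at y within closed_segment c x)"
      using has_deriv01[OF f y01] seg by (rule has_vector_derivative_within_subset)
    have "\<bar>y - c\<bar> \<le> w"
      using y xc(3) by (auto simp: closed_segment_eq_real_ivl split: if_splits)
    then show "norm (deriv01 f y - deriv01 f c) \<le> 2 * \<beta> * w powr (\<alpha> - 1)"
      using slope[OF y01] by simp
  qed auto
  then show "\<bar>f x - f c - deriv01 f c * (x - c)\<bar> \<le> 2 * \<beta> * w powr (\<alpha> - 1) * \<bar>x - c\<bar>"
    by (simp add: mult_ac)
qed

text \<open>The condition \<open>fine\<close> keeps the tangent at a column center within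
  \<open>thick n j / 8\<close> of the graph over that column, and within \<open>delta1 n j\<close>
  at the next center.\<close>

locale covering =
  fixes f :: "real \<Rightarrow> real" and \<alpha> \<beta> S :: real and n j :: nat
  assumes f: "f \<in> Holder_slope \<alpha> \<beta> S" and \<alpha>: "1 < \<alpha>" "\<alpha> \<le> 2" and \<beta>: "0 < \<beta>"
    and fine: "\<beta> * width j powr (\<alpha> - 1) * width j \<le> thick n j / 8"
begin

definition center :: "nat \<Rightarrow> real" where
  "center k = (real k + 1/2) * width j"

definition height :: "nat \<Rightarrow> int" where
  "height k = \<lfloor>f (center k) / delta1 n j\<rfloor>"

definition slope :: "nat \<Rightarrow> int" where
  "slope k = \<lfloor>deriv01 f (center k) / delta2 n j\<rfloor>"

definition cover :: "nat \<Rightarrow> (real \<times> real) set" where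
  "cover k = region n j (int k) (height k) (slope k)"

lemma column_in_unit:
  assumes "k < 2 ^ j"
  shows "0 \<le> real k * width j" "(real k + 1) * width j \<le> 1"
proof -
  show "0 \<le> real k * width j" using less_imp_le[OF width_pos[of j]] by simp
  have "real (Suc k) \<le> real (2 ^ j)" using assms by (subst of_nat_le_iff) simp
  then show "(real k + 1) * width j \<le> 1"
    by (simp add: width_eq add.commute)
qed

lemma center_in_column: "real k * width j \<le> center k" "center k \<le> (real k + 1) * width j"
  using less_imp_le[OF width_pos[of j]] by (simp_all add: center_def distrib_right)

lemma center_in_unit:
  assumes "k < 2 ^ j"
  shows "center k \<in> {0..1}"
  using column_in_unit[OF assms] center_in_column[of k] by auto

lemma height_error: "0 \<le> f (center k) - of_int (height k) * delta1 n j"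
  "f (center k) - of_int (height k) * delta1 n j < delta1 n j"
proof -
  have "of_int (height k) \<le> f (center k) / delta1 n j" "f (center k) / delta1 n j < of_int (height k) + 1"
    unfolding height_def by linarith+
  then show "0 \<le> f (center k) - of_int (height k) * delta1 n j"
    "f (center k) - of_int (height k) * delta1 n j < delta1 n j"
    by (simp_all add: pos_le_divide_eq pos_divide_less_eq distrib_right)
qed

lemma slope_error: "0 \<le> deriv01 f (center k) - of_int (slope k) * delta2 n j"
  "deriv01 f (center k) - of_int (slope k) * delta2 n j < delta2 n j"
proof -
  have "of_int (slope k) \<le> deriv01 f (center k) / delta2 n j"
    "deriv01 f (center k) / delta2 n j < of_int (slope k) + 1"
    unfolding slope_def by linarith+
  then show "0 \<le> deriv01 f (center k) - of_int (slope k) * delta2 n j"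
    "deriv01 f (center k) - of_int (slope k) * delta2 n j < delta2 n j"
    by (simp_all add: pos_le_divide_eq pos_divide_less_eq distrib_right)
qed

lemma cover_in_regions:
  assumes "k < 2 ^ j"
  shows "cover k \<in> regions S n j"
proof -
  note c = center_in_unit[OF assms]
  have f01: "0 \<le> f (center k)" "f (center k) \<le> 1" and g: "\<bar>deriv01 f (center k)\<bar> \<le> S"
    using f c by (auto simp: Holder_slope_def Holder_def Pi_iff)
  have "0 \<le> height k"
    unfolding height_def using f01 less_imp_le[OF delta1_pos[of n j]] by simp
  moreover have "height k \<le> \<lfloor>1 / delta1 n j\<rfloor>"
    unfolding height_def using f01 less_imp_le[OF delta1_pos[of n j]]
    by (intro floor_mono divide_right_mono)
  moreover have "\<lfloor>- (S / delta2 n j)\<rfloor> \<le> slope k"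
    unfolding slope_def minus_divide_left using g less_imp_le[OF delta2_pos[of n j]]
    by (intro floor_mono divide_right_mono) auto
  then have "- \<lceil>S / delta2 n j\<rceil> \<le> slope k" by (simp add: floor_minus)
  moreover have "slope k \<le> \<lfloor>S / delta2 n j\<rfloor>"
    unfolding slope_def using g less_imp_le[OF delta2_pos[of n j]]
    by (intro floor_mono divide_right_mono) auto
  then have "slope k \<le> \<lceil>S / delta2 n j\<rceil>" using floor_le_ceiling order_trans by blast
  moreover have "int k < 2 ^ j" using assms by (metis of_nat_less_iff of_nat_numeral of_nat_power)
  ultimately show ?thesis
    by (simp add: cover_def region_in_regions region_idx_def)
qed

text \<open>The half-thickness is spent in three parts: an eighth of the thickness on linearization,
  an eighth on rounding the slope, and a quarter on rounding the height.\<close>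

lemma graph_in_cover:
  assumes k: "k < 2 ^ j" and x: "real k * width j \<le> x" "x \<le> (real k + 1) * width j"
  shows "(x, f x) \<in> cover k"
proof -
  let ?w = "width j" and ?c = "center k" and ?t = "thick n j"
  have w: "0 < ?w" by simp
  have x01: "x \<in> {0..1}" using x column_in_unit[OF k] by auto
  have xc: "\<bar>x - ?c\<bar> \<le> ?w / 2"
    using x unfolding center_def abs_le_iff by (simp add: algebra_simps)
  have "\<bar>f x - f ?c - deriv01 f ?c * (x - ?c)\<bar> \<le> 2 * \<beta> * ?w powr (\<alpha> - 1) * \<bar>x - ?c\<bar>"
    using xc w by (intro linearization_bound[OF f \<alpha> \<beta> x01 center_in_unit[OF k]]) linarith
  also have "\<dots> \<le> 2 * \<beta> * ?w powr (\<alpha> - 1) * (?w / 2)"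
    by (rule mult_left_mono[OF xc]) (use \<beta> in simp)
  also have "\<dots> \<le> ?t / 8" using fine by simp
  finally have 1: "\<bar>f x - f ?c - deriv01 f ?c * (x - ?c)\<bar> \<le> ?t / 8" .
  have "\<bar>(deriv01 f ?c - of_int (slope k) * delta2 n j) * (x - ?c)\<bar> \<le> delta2 n j * (?w / 2)"
    unfolding abs_mult using slope_error[of k] xc by (intro mult_mono) auto
  also have "\<dots> = ?t / 8" using delta2_times_width[of n j] by (simp add: delta1_def mult.commute)
  finally have 2: "\<bar>(deriv01 f ?c - of_int (slope k) * delta2 n j) * (x - ?c)\<bar> \<le> ?t / 8" .
  have 3: "\<bar>f ?c - of_int (height k) * delta1 n j\<bar> \<le> ?t / 4"
    using height_error[of k] by (simp add: delta1_def)
  have "f x - of_int (height k) * delta1 n j - of_int (slope k) * delta2 n j * (x - ?c) =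
      (f x - f ?c - deriv01 f ?c * (x - ?c)) +
      (deriv01 f ?c - of_int (slope k) * delta2 n j) * (x - ?c) +
      (f ?c - of_int (height k) * delta1 n j)"
    by (simp add: algebra_simps)
  then have "\<bar>f x - of_int (height k) * delta1 n j - of_int (slope k) * delta2 n j * (x - ?c)\<bar> \<le> ?t / 2"
    using 1 2 3 by linarith
  then show ?thesis
    unfolding cover_def mem_region center_def using x by simp
qed

text \<open>Because \<open>delta2 n j * width j\<close> equals \<open>delta1 n j\<close>, following
  the rounded slope across one column changes the height index by exactly \<open>slope k\<close>.
  The linearization error, the slope rounding and the difference of the height roundings contribute
  at most one unit each to \<open>u\<close>; \<open>v\<close> is bounded in the same way.\<close>

lemma cover_edge:
  assumes "Suc k < 2 ^ j"
  shows "(cover k, cover (Suc k)) \<in> edges S n j"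
proof -
  let ?w = "width j" and ?c = "center k" and ?c' = "center (Suc k)" and ?t = "thick n j"
  let ?d1 = "delta1 n j" and ?d2 = "delta2 n j"
  have w: "0 < ?w" by simp
  have d: "0 < ?d1" "0 < ?d2" by simp_all
  have w': "0 \<le> ?w" using w by (rule less_imp_le)
  have cc: "?c' - ?c = ?w" by (simp add: center_def algebra_simps)
  have k: "k < 2 ^ j" using assms by simp
  note c = center_in_unit[OF k] center_in_unit[OF assms]
  have "\<bar>f ?c' - f ?c - deriv01 f ?c * (?c' - ?c)\<bar> \<le> 2 * \<beta> * ?w powr (\<alpha> - 1) * \<bar>?c' - ?c\<bar>"
    using w' by (intro linearization_bound[OF f \<alpha> \<beta> c(2,1)]) (simp add: cc)
  also have "\<dots> = 2 * (\<beta> * ?w powr (\<alpha> - 1) * ?w)" using w' by (simp add: cc)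
  also have "\<dots> \<le> ?d1" using fine by (simp add: delta1_def)
  finally have lin: "\<bar>f ?c' - f ?c - deriv01 f ?c * ?w\<bar> \<le> ?d1" by (simp add: cc)
  have "\<bar>deriv01 f ?c' - deriv01 f ?c\<bar> * ?w \<le> (2 * \<beta> * ?w powr (\<alpha> - 1)) * ?w"
    using w' by (intro mult_right_mono linearization_bound[OF f \<alpha> \<beta> c(2,1)]) (simp_all add: cc)
  also have "\<dots> \<le> ?d1" using fine by (simp add: delta1_def)
  also have "\<dots> = ?d2 * ?w" by (simp add: delta2_times_width)
  finally have dd: "\<bar>deriv01 f ?c' - deriv01 f ?c\<bar> \<le> ?d2"
    using w by simp
  define v where "v = slope (Suc k) - slope k"
  define u where "u = height (Suc k) - height k - slope k"
  have "\<bar>of_int v * ?d2\<bar> \<le> 4 * ?d2"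
    using dd slope_error[of k] slope_error[of "Suc k"] by (simp add: v_def left_diff_distrib abs_le_iff)
  then have v: "\<bar>v\<bar> \<le> 4"
    using d by (simp add: abs_mult)
  have sw: "0 \<le> deriv01 f ?c * ?w - of_int (slope k) * ?d1" "deriv01 f ?c * ?w - of_int (slope k) * ?d1 \<le> ?d1"
    using mult_right_mono[OF slope_error(1)[of k], of ?w]
      mult_right_mono[OF less_imp_le[OF slope_error(2)[of k]], of ?w] w
      delta2_times_width[of n j]
    by (simp_all add: left_diff_distrib mult.assoc)
  have "\<bar>of_int u * ?d1\<bar> \<le> 4 * ?d1"
    using lin sw height_error[of k] height_error[of "Suc k"]
    by (simp add: u_def left_diff_distrib abs_le_iff)
  then have u: "\<bar>u\<bar> \<le> 4"
    using d by (simp add: abs_mult)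
  have "cover (Suc k) = region n j (int k + 1) (height k + slope k + u) (slope k + v)"
    by (simp add: cover_def u_def v_def add.commute)
  then have eq: "(cover k, cover (Suc k)) =
      (region n j (int k) (height k) (slope k), region n j (int k + 1) (height k + slope k + u) (slope k + v))"
    by (simp only: cover_def)
  have "region n j (int k) (height k) (slope k) \<in> regions S n j"
    "region n j (int k + 1) (height k + slope k + u) (slope k + v) \<in> regions S n j"
    using cover_in_regions[OF k] cover_in_regions[OF assms] eq by (simp_all only: prod.inject)
  with u v show ?thesis
    unfolding edges_def by (intro CollectI exI conjI) (rule eq)
qed

lemma run_rejects:
  assumes j: "j \<le> Jmax n" and m: "m + L \<le> 2 ^ j" and L: "Ls < real L"
    and sig: "\<And>k. m \<le> k \<Longrightarrow> k < m + L \<Longrightarrow> significant n N X (cover k)"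
  shows "test_rejects S n N Ls X"
proof -
  let ?p = "map cover [m..<m + L]"
  have "significant_path S n j N X ?p"
    unfolding significant_path_def
    using sig m cover_in_regions by (auto simp: successively_conv_nth cover_edge)
  moreover have "Ls < real (length ?p)" using L by simp
  ultimately show ?thesis
    unfolding test_rejects_iff using j by blast
qed

text \<open>Neighbouring regions may overlap along a common vertical line. Dropping the right edge
  makes the sets disjoint, as the multinomial bounds require, and many points in a cell still make
  its region significant.\<close>

definition cell :: "nat \<Rightarrow> (real \<times> real) set" where
  "cell k = cover k \<inter> {z. fst z < (real k + 1) * width j}"

lemma sets_cell: "cell k \<in> sets borel"
  unfolding cell_def cover_def
  by (intro sets.Int borel_closed closed_region borel_open open_Collect_less continuous_intros)

lemma disjoint_cells: "disjoint_family_on cell A"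
proof -
  have "cell k \<inter> cell l = {}" if "k < l" for k l
  proof -
    have "real k + 1 \<le> real l" using that by simp
    then have "(real k + 1) * width j \<le> real l * width j"
      by (intro mult_right_mono) (simp_all add: less_imp_le)
    moreover have "real l * width j \<le> fst z" if "z \<in> cell l" for z
      using that by (cases z) (simp add: cell_def cover_def mem_region)
    moreover have "fst z < (real k + 1) * width j" if "z \<in> cell k" for z
      using that by (simp add: cell_def)
    ultimately show ?thesis
      by (meson disjoint_iff leD less_le_trans)
  qed
  then show ?thesis
    unfolding disjoint_family_on_def by (metis inf_commute linorder_neqE_nat)
qed

text \<open>If the test accepts, every complete block of \<open>L\<close> columns contains a cell
  with at most \<open>N\<close> points, since a block of full cells is a significant path longer
  than \<open>Ls\<close>. \<open>no_full_run_bound\<close> with \<open>r = Suc N\<close> bounds the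
  probability of this.\<close>

lemma power_bound:
  fixes N n0 :: nat
  assumes n: "0 < n" and j: "j \<le> Jmax n" and \<epsilon>: "\<epsilon> \<in> {0..1}"
    and \<eta>: "2 ^ Suc N * exp (- (\<epsilon> * width j / sqrt (1 + S\<^sup>2) * n0 / 2)) \<le> \<eta>" "\<eta> \<le> 1"
    and n0: "n0 + L * Suc N \<le> n" and L: "Ls < real L"
  shows "1 - (1 - (1 - \<eta>) ^ L) ^ (2 ^ j div L)
    \<le> \<P>(X in iid_law n (mixture \<epsilon> uniform_square (uniform_graph f)). test_rejects S n N Ls X)"
proof -
  define D where "D = mixture \<epsilon> uniform_square (uniform_graph f)"
  have sets_D: "sets D = sets borel" by (simp add: D_def)
  interpret D: prob_space D
    unfolding D_def using sets_uniform_square prob_space_uniform_square prob_space_uniform_graph[OF f] f \<epsilon>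
    by (intro prob_space_mixture) auto
  interpret PP: product_prob_space "\<lambda>_. D" "{1..n}" by standard
  interpret P: prob_space "iid_law n D"
    unfolding iid_law_def by (rule PP.prob_space_axioms)
  let ?bad = "{X \<in> space (iid_law n D). \<forall>b<2 ^ j div L. \<exists>k\<in>{b * L..<Suc b * L}.
    card {i \<in> {1..n}. X i \<in> cell k} < Suc N}"
  let ?rej = "{X \<in> space (iid_law n D). test_rejects S n N Ls X}"
  have rej: "?rej \<in> P.events" by (rule sets_test_rejects[OF sets_D])
  have sub: "space (iid_law n D) - ?rej \<subseteq> ?bad"
  proof safe
    fix X b assume X: "X \<in> space (iid_law n D)" and no: "\<not> test_rejects S n N Ls X"
      and b: "b < 2 ^ j div L"
    show "\<exists>k\<in>{b * L..<Suc b * L}. card {i \<in> {1..n}. X i \<in> cell k} < Suc N"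
    proof (rule ccontr)
      assume *: "\<not> ?thesis"
      have "test_rejects S n N Ls X"
      proof (rule run_rejects[OF j _ L])
        have "Suc b * L \<le> 2 ^ j div L * L" using b by (intro mult_le_mono1) simp
        also have "\<dots> \<le> 2 ^ j" by simp
        finally show "b * L + L \<le> 2 ^ j" by simp
        fix k assume "b * L \<le> k" "k < b * L + L"
        then have "Suc N \<le> card {i \<in> {1..n}. X i \<in> cell k}" using * by force
        also have "\<dots> \<le> count_in n X (cover k)"
          unfolding count_in_def by (intro card_mono) (auto simp: cell_def)
        finally show "significant n N X (cover k)" by (simp add: significant_def)
      qed
      with no show False by contradiction
    qed
  qed
  have bad: "?bad \<in> P.events"
  proof -
    have "{X \<in> space (iid_law n D). real N < count_in n X (cell k)} \<in> P.events" for k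
      using sets_significant[OF sets_D sets_cell, of n N k] by (simp add: significant_def)
    then have c: "{X \<in> space (iid_law n D). \<not> real N < count_in n X (cell k)} \<in> P.events" for k
      by (rule sets.sets_Collect_neg)
    have "?bad = {X \<in> space (iid_law n D). \<forall>b\<in>{..<2 ^ j div L}. \<exists>k\<in>{b * L..<Suc b * L}.
        \<not> real N < count_in n X (cell k)}"
      by (auto simp: count_in_def less_Suc_eq_le not_less)
    also have "\<dots> \<in> P.events"
      by (intro sets.sets_Collect_finite_All sets.sets_Collect_finite_Ex c) auto
    finally show ?thesis .
  qed
  have "1 - P.prob ?rej = P.prob (space (iid_law n D) - ?rej)"
    using rej by (simp add: P.prob_compl)
  also have "\<dots> \<le> P.prob ?bad"
    using sub bad by (intro P.finite_measure_mono)
  also have "\<dots> \<le> (1 - (1 - \<eta>) ^ L) ^ (2 ^ j div L)"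
    unfolding iid_law_def
  proof (rule no_full_run_bound[OF D.prob_space_axioms _ disjoint_cells _ \<eta>])
    show "cell k \<in> sets D" for k by (simp add: sets_D sets_cell)
    show "\<epsilon> * width j / sqrt (1 + S\<^sup>2) \<le> measure D (cell k)" if "k < 2 ^ j" for k
    proof -
      have "\<epsilon> * ((real k + 1) * width j - real k * width j) / sqrt (1 + S\<^sup>2) \<le> measure D (cell k)"
        unfolding D_def
        using \<epsilon> column_in_unit[OF that] less_imp_le[OF width_pos[of j]] graph_in_cover[OF that]
        by (intro mixture_strip[OF f prob_space_uniform_square sets_uniform_square _ sets_cell])
          (auto simp: cell_def distrib_right)
      then show ?thesis by (simp add: distrib_right)
    qed
  qed (use n0 in auto)
  finally show ?thesis by (simp add: D_def)
qed

end

section \<open>Choice of the scale and an explicit power bound\<close>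

lemma power_along_scale:
  fixes N n :: nat and \<alpha> \<beta> S \<tau> :: real
  assumes \<alpha>: "1 < \<alpha>" "\<alpha> \<le> 2" and \<beta>: "0 < \<beta>" and P: "P \<in> H1 n \<alpha> \<beta> S \<tau>" and "0 \<le> \<tau>"
    and \<tau>: "2 ^ Suc N * exp (- (\<tau> / (12 * (8 * \<beta>) powr (1 / (1 + \<alpha>)) * sqrt (1 + S\<^sup>2)))) \<le> 1 - exp (- 1 / 12)"
    and n: "3 \<le> n" "1 \<le> 8 * \<beta> * n" "2 * (8 * \<beta> * n) powr (1 / (1 + \<alpha>)) \<le> n"
      "(ln n + 1) * Suc N \<le> real n / 2"
  shows "1 - exp (- (exp (- (ln n + 1) / 12) * ((8 * \<beta> * n) powr (1 / 3) / (ln n + 1) - 1)))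
    \<le> \<P>(X in P. test_rejects S n N (ln n) X)"
proof -
  from P obtain f \<epsilon> where f: "f \<in> Holder_slope \<alpha> \<beta> S" and \<epsilon>: "\<epsilon> \<in> {0..1}"
    and \<epsilon>\<tau>: "\<tau> * real n powr (- \<alpha> / (1 + \<alpha>)) < \<epsilon>"
    and P_eq: "P = iid_law n (mixture \<epsilon> uniform_square (uniform_graph f))"
    by (auto simp: H1_def)
  \<comment> \<open>The scale is the coarsest with \<open>2 ^ j\<close> at least \<open>B\<close>,
    so \<open>K\<close> lies between \<open>B\<close> and \<open>2 * B\<close>. The value of
    \<open>B\<close> solves \<open>B powr (1 + \<alpha>) = 8 * \<beta> * n\<close>, which is the
    fineness condition after inserting \<open>2 ^ Jmax n \<le> 2 * n\<close>.\<close>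
  define e where "e = 1 / (1 + \<alpha>)"
  define B where "B = (8 * \<beta> * n) powr e"
  define j where "j = nat \<lceil>log 2 B\<rceil>"
  define K where "K = (2::real) ^ j"
  \<comment> \<open>The least integer above \<open>ln n\<close>, so that a run of \<open>L\<close>
    regions just passes the threshold.\<close>
  define L where "L = Suc (nat \<lfloor>ln (real n)\<rfloor>)"
  define s where "s = sqrt (1 + S\<^sup>2)"
  have n0: "0 < real n" using n by simp
  have s0: "0 < s" by (simp add: s_def add_pos_nonneg)
  have e: "0 < e" "1 / 3 \<le> e" using \<alpha> by (auto simp: e_def field_simps)
  have B1: "1 \<le> B" unfolding B_def using n e by (intro ge_one_powr_ge_zero) auto
  then have logB: "0 \<le> log 2 B" by simp
  have jK: "K = 2 powr j" by (simp add: K_def powr_realpow)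
  have j_eq: "real j = of_int \<lceil>log 2 B\<rceil>" using logB by (simp add: j_def)
  have BK: "B \<le> K"
  proof -
    have "B = 2 powr log 2 B" using B1 by simp
    also have "\<dots> \<le> K" unfolding jK j_eq by (intro powr_mono) auto
    finally show ?thesis .
  qed
  have KB: "K \<le> 2 * B"
  proof -
    have "K \<le> 2 powr (log 2 B + 1)" unfolding jK j_eq by (intro powr_mono) (simp_all add: of_int_ceiling_le_add_one)
    also have "\<dots> = 2 * B" using B1 by (simp add: powr_add)
    finally show ?thesis .
  qed
  have K0: "0 < K" by (simp add: K_def)
  have w: "width j = 1 / K" by (simp add: width_eq K_def)
  have npos: "0 < n" using n by simp
  note J = Jmax_bounds[OF npos]
  have "K \<le> 2 ^ Jmax n"
    using KB n(3) J unfolding B_def e_def by linarith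
  then have jJ: "j \<le> Jmax n" unfolding K_def by (simp add: power_increasing_iff)
  have fine: "\<beta> * width j powr (\<alpha> - 1) * width j \<le> thick n j / 8"
  proof -
    have "8 * \<beta> * n = B powr (1 + \<alpha>)"
      unfolding B_def powr_powr e_def using \<alpha> \<beta> n0 by simp
    also have "\<dots> \<le> K powr (1 + \<alpha>)"
      using BK B1 \<alpha> by (intro powr_mono2) auto
    finally have main: "8 * \<beta> * n \<le> K powr (1 + \<alpha>)" .
    have "\<beta> * width j powr (\<alpha> - 1) * width j = \<beta> / (K powr (\<alpha> - 1) * K)"
      using K0 by (simp add: w powr_divide)
    also have "K powr (\<alpha> - 1) * K = K powr (1 + \<alpha>) / K"
    proof -
      have "K powr (1 + \<alpha>) = K powr (\<alpha> - 1) * K powr 2"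
        by (simp flip: powr_add)
      then show ?thesis using K0 by (simp add: power2_eq_square)
    qed
    also have "\<beta> / (K powr (1 + \<alpha>) / K) \<le> K / (8 * n)"
      using main K0 n0 \<beta> by (simp add: field_simps)
    also have "\<dots> \<le> K / (4 * 2 ^ Jmax n)"
      using K0 J n0 by (intro divide_left_mono) auto
    also have "\<dots> = thick n j / 8" by (simp add: thick_eq K_def)
    finally show ?thesis .
  qed
  interpret covering f \<alpha> \<beta> S n j
    by unfold_locales (use f \<alpha> \<beta> fine in auto)
  have ln1: "1 \<le> ln (real n)"
  proof -
    have "exp 1 \<le> real n" using exp_le n(1) by linarith
    then show ?thesis using n0 by (simp add: ln_ge_iff)
  qed
  have L: "ln n < L" "real L \<le> ln n + 1"
    unfolding L_def using ln1 by linarith+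
  \<comment> \<open>Since \<open>B\<close> is \<open>(8 * \<beta>) powr e\<close> times
    \<open>n powr e\<close>, and the lower bound on \<open>\<epsilon>\<close> is
    \<open>\<tau>\<close> times \<open>n powr (e - 1)\<close>, only the factor \<open>1 / n\<close>
    survives: a cell expects at least a constant times \<open>\<tau>\<close> points.\<close>
  have \<epsilon>_low: "\<tau> / (2 * (8 * \<beta>) powr e * s * n) \<le> \<epsilon> * width j / s"
  proof -
    have B_split: "B = (8 * \<beta>) powr e * n powr e"
      unfolding B_def using \<beta> n0 by (simp add: powr_mult)
    have npow: "real n powr (- \<alpha> / (1 + \<alpha>)) = n powr e / n"
    proof -
      have "- \<alpha> / (1 + \<alpha>) = e - 1" using \<alpha> by (simp add: e_def field_simps)
      then show ?thesis using n0 by (simp add: powr_diff)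
    qed
    have "\<tau> / (2 * (8 * \<beta>) powr e * s * n) = \<tau> * real n powr (- \<alpha> / (1 + \<alpha>)) / (2 * B) / s"
      unfolding B_split npow using n0 \<beta> by (simp add: field_simps)
    also have "\<dots> \<le> \<epsilon> / K / s"
      using \<epsilon>\<tau> KB K0 s0 \<epsilon> by (intro divide_right_mono frac_le) auto
    finally show ?thesis by (simp add: w)
  qed
  have Lpos: "0 < L" by (simp add: L_def)
  have "1 - exp (- (exp (- (ln n + 1) / 12) * ((8 * \<beta> * n) powr (1 / 3) / (ln n + 1) - 1))) \<le>
      1 - exp (- (exp (- real L / 12) * (2 ^ j div L)))"
  proof -
    \<comment> \<open>As \<open>\<alpha> \<le> 2\<close>, the exponent \<open>e\<close> is at least
      1/3; this gives a count of blocks that is uniform in \<open>\<alpha>\<close>, and the 1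
      subtracted pays for the incomplete block.\<close>
    have "(8 * \<beta> * n) powr (1 / 3) / (ln n + 1) - 1 \<le> K / L - 1"
    proof -
      have "(8 * \<beta> * n) powr (1 / 3) \<le> B" unfolding B_def using e n by (intro powr_mono) auto
      then show ?thesis using BK L Lpos K0 by (intro diff_right_mono frac_le) auto
    qed
    also have "\<dots> \<le> real (2 ^ j div L)"
    proof -
      have "(2::nat) ^ j < Suc (2 ^ j div L) * L"
        using Lpos by (metis dividend_less_times_div mult_Suc_right mult.commute add.commute)
      then have "K < real (Suc (2 ^ j div L) * L)"
        unfolding K_def by (metis of_nat_less_iff of_nat_numeral of_nat_power)
      then have "K / L < real (Suc (2 ^ j div L))" using Lpos by (simp add: pos_divide_less_eq distrib_right)
      then show ?thesis by simp
    qed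
    finally have le: "(8 * \<beta> * n) powr (1 / 3) / (ln n + 1) - 1 \<le> real (2 ^ j div L)" .
    have "exp (- (ln n + 1) / 12) * ((8 * \<beta> * n) powr (1 / 3) / (ln n + 1) - 1) \<le>
        exp (- (ln n + 1) / 12) * real (2 ^ j div L)"
      using le by (intro mult_left_mono) auto
    also have "\<dots> \<le> exp (- real L / 12) * real (2 ^ j div L)"
      using L by (intro mult_right_mono) auto
    finally show ?thesis by simp
  qed
  \<comment> \<open>With \<open>\<eta> = 1 - exp (- 1 / 12)\<close> a block is full with probability
    at least \<open>exp (- L / 12)\<close>, of order \<open>n powr (- 1 / 12)\<close>, which the
    more than \<open>n powr (1 / 4)\<close> blocks available for large \<open>n\<close>
    outweigh.\<close>
  also have "\<dots> \<le> 1 - (1 - (1 - (1 - exp (- 1 / 12))) ^ L) ^ (2 ^ j div L)"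
  proof -
    have "(1 - (1 - exp (- 1 / 12))) ^ L = exp (- real L / 12)"
      by (simp add: exp_of_nat_mult[symmetric])
    moreover have "(1 - exp (- real L / 12)) ^ (2 ^ j div L) \<le> exp (- exp (- real L / 12)) ^ (2 ^ j div L)"
      using exp_ge_add_one_self[of "- exp (- real L / 12)"] by (intro power_mono) auto
    moreover have "exp (- exp (- real L / 12)) ^ (2 ^ j div L) = exp (- (exp (- real L / 12) * (2 ^ j div L)))"
      unfolding exp_of_nat_mult[symmetric] by (simp add: mult.commute)
    ultimately show ?thesis by simp
  qed
  also have "\<dots> \<le> \<P>(X in P. test_rejects S n N (ln n) X)"
    unfolding P_eq
  proof (rule power_bound[OF npos jJ \<epsilon>])
    show "ln n < real L" by (rule L(1))
    have "real (L * Suc N) \<le> (ln n + 1) * Suc N"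
      using L unfolding of_nat_mult by (intro mult_right_mono) auto
    then have "real (L * Suc N) \<le> real n / 2" using n(4) by linarith
    \<comment> \<open>Half of the draws serve as \<open>n0\<close> for the marginal bounds; the
      other half is the reserve for reaching \<open>L\<close> thresholds of \<open>Suc N\<close>
      points.\<close>
    then show "n div 2 + L * Suc N \<le> n" by linarith
    show "1 - exp (- 1 / 12) \<le> (1::real)" by simp
    \<comment> \<open>The 12 is the product of 2 from \<open>K \<le> 2 * B\<close>, 3 from
      \<open>n div 2 \<ge> n / 3\<close>, and 2 from the halved exponent in the marginal
      bound.\<close>
    have "\<tau> / (12 * (8 * \<beta>) powr e * s) = \<tau> / (2 * (8 * \<beta>) powr e * s * n) * (real n / 3) / 2"
      using n0 by simp
    also have "\<dots> \<le> \<epsilon> * width j / s * real (n div 2) / 2"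
    proof (intro divide_right_mono mult_mono \<epsilon>_low)
      show "real n / 3 \<le> real (n div 2)" using n(1) by linarith
      show "0 \<le> \<epsilon> * width j / s" using \<epsilon> s0 by (simp add: w K0 less_imp_le)
    qed (use n0 in auto)
    finally have "2 ^ Suc N * exp (- (\<epsilon> * width j / s * real (n div 2) / 2)) \<le>
        2 ^ Suc N * exp (- (\<tau> / (12 * (8 * \<beta>) powr e * s)))" by simp
    also have "\<dots> \<le> 1 - exp (- 1 / 12)" using \<tau> by (simp add: e_def s_def)
    finally show "2 ^ Suc N * exp (- (\<epsilon> * width j / sqrt (1 + S\<^sup>2) * real (n div 2) / 2)) \<le> 1 - exp (- 1 / 12)"
      by (simp add: s_def)
  qed
  finally show ?thesis .
qed

section \<open>Choice of the thresholds and passage to the limit\<close>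

theorem theorem3p1:
  fixes S :: real
  assumes "S > 1"
  shows "\<exists>(Nstar :: real) (Lstar :: nat \<Rightarrow> real).
    (\<forall>\<alpha> \<beta> :: real. 1 < \<alpha> \<and> \<alpha> \<le> 2 \<and> \<beta> > 0 \<longrightarrow>
      (\<exists>T > 0. \<forall>\<tau> > T. \<forall>P :: nat \<Rightarrow> (nat \<Rightarrow> real \<times> real) measure.
        (\<forall>\<^sub>F n in sequentially. P n \<in> H1 n \<alpha> \<beta> S \<tau>) \<longrightarrow>
        (\<lambda>n. \<P>(X in P n. test_rejects S n Nstar (Lstar n) X)) \<longlonglongrightarrow> 1)) \<and>
    (\<lambda>n. \<P>(X in H0 n. test_rejects S n Nstar (Lstar n) X)) \<longlonglongrightarrow> 0"
proof -
  \<comment> \<open>\<open>N\<close> is fixed by the null hypothesis alone, before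
    \<open>\<alpha>\<close> and \<open>\<beta>\<close> appear; the power is then secured through
    \<open>\<tau>\<close>.\<close>
  obtain N :: nat where "81 * exp 4 / exp (- 6) < (2::real) ^ N"
    using real_arch_pow[of 2 "81 * exp 4 / exp (- 6)"] by auto
  then have N: "81 * exp 4 / 2 ^ N \<le> exp (- 6 :: real)"
    by (simp add: field_simps)
  have null: "(\<lambda>n. \<P>(X in H0 n. test_rejects S n N (ln n) X)) \<longlonglongrightarrow> 0"
  proof (rule tendsto_sandwich[where f = "\<lambda>_. 0"])
    show "\<forall>\<^sub>F n in sequentially. \<P>(X in H0 n. test_rejects S n N (ln n) X) \<le> 20 * (8 * S * n + 3) / real n ^ 3"
      using eventually_gt_at_top[of 0]
    proof eventually_elim
      case (elim n)
      then show ?case using assms N by (intro false_alarm_bound) auto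
    qed
    show "(\<lambda>n. 20 * (8 * S * real n + 3) / real n ^ 3) \<longlonglongrightarrow> 0"
      using assms by real_asymp
  qed auto
  have power: "\<exists>T>0. \<forall>\<tau>>T. \<forall>P :: nat \<Rightarrow> (nat \<Rightarrow> real \<times> real) measure.
      (\<forall>\<^sub>F n in sequentially. P n \<in> H1 n \<alpha> \<beta> S \<tau>) \<longrightarrow>
      (\<lambda>n. \<P>(X in P n. test_rejects S n N (ln n) X)) \<longlonglongrightarrow> 1"
    if \<alpha>: "1 < \<alpha>" "\<alpha> \<le> 2" and \<beta>: "0 < \<beta>" for \<alpha> \<beta> :: real
  proof -
    \<comment> \<open>\<open>Q\<close> is the denominator in the condition on \<open>\<tau>\<close>
      of \<open>power_along_scale\<close>; beyond \<open>T\<close> that condition holds.\<close>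
    define Q where "Q = 12 * (8 * \<beta>) powr (1 / (1 + \<alpha>)) * sqrt (1 + S\<^sup>2)"
    have Q: "0 < Q" using \<beta> by (simp add: Q_def add_pos_nonneg)
    have "((\<lambda>\<tau>. 2 ^ Suc N * exp (- (\<tau> / Q))) \<longlongrightarrow> 0) at_top"
      using Q by real_asymp
    then have "\<forall>\<^sub>F \<tau> in at_top. 2 ^ Suc N * exp (- (\<tau> / Q)) < 1 - exp (- 1 / 12)"
      by (rule order_tendstoD) simp
    then obtain T where T: "\<And>\<tau>. \<tau> \<ge> T \<Longrightarrow> 2 ^ Suc N * exp (- (\<tau> / Q)) < 1 - exp (- 1 / 12)"
      by (auto simp: eventually_at_top_linorder)
    show ?thesis
    \<comment> \<open>The maximum with 1 makes the constant positive, hence also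
      \<open>\<tau>\<close>.\<close>
    proof (intro exI[of _ "max T 1"] conjI allI impI)
      fix \<tau> :: real and P :: "nat \<Rightarrow> (nat \<Rightarrow> real \<times> real) measure"
      assume \<tau>: "max T 1 < \<tau>" and P: "\<forall>\<^sub>F n in sequentially. P n \<in> H1 n \<alpha> \<beta> S \<tau>"
      \<comment> \<open>The inner exponential is a constant times \<open>n powr (- 1 / 12)\<close>
        and the other factor grows like \<open>n powr (1 / 3) / ln n\<close>, so their product tends
        to infinity and \<open>lower\<close> to 1.\<close>
      define lower where "lower n = 1 - exp (- (exp (- (ln n + 1) / 12) *
        ((8 * \<beta> * n) powr (1 / 3) / (ln n + 1) - 1)))" for n :: real
      have e: "0 < 1 / (1 + \<alpha>)" "1 / (1 + \<alpha>) < 1" using \<alpha> by auto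
      have "\<forall>\<^sub>F n in sequentially. 2 * (8 * \<beta> * real n) powr e \<le> real n" if "0 < e" "e < 1" for e
        using that \<beta> by real_asymp
      from this[OF e] have scale: "\<forall>\<^sub>F n in sequentially. 2 * (8 * \<beta> * real n) powr (1 / (1 + \<alpha>)) \<le> real n" .
      have "\<forall>\<^sub>F n in sequentially. 1 \<le> 8 * \<beta> * real n"
        using \<beta> by real_asymp
      moreover have "\<forall>\<^sub>F n in sequentially. (ln (real n) + 1) * Suc N \<le> real n / 2"
        by real_asymp
      ultimately have low: "\<forall>\<^sub>F n in sequentially. lower n \<le> \<P>(X in P n. test_rejects S n N (ln n) X)"
        using P scale eventually_ge_at_top[of 3]
      proof eventually_elim
        case (elim n)
        then show ?case
          unfolding lower_def using \<alpha> \<beta> \<tau> T[of \<tau>]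
          by (intro power_along_scale) (auto simp: Q_def)
      qed
      show "(\<lambda>n. \<P>(X in P n. test_rejects S n N (ln n) X)) \<longlonglongrightarrow> 1"
      proof (rule tendsto_sandwich[OF low])
        show "(\<lambda>n. lower (real n)) \<longlonglongrightarrow> 1"
          unfolding lower_def using \<beta> by real_asymp
        \<comment> \<open>That \<open>P n\<close> is a probability measure comes from membership in
          \<open>H1\<close>, hence only for large \<open>n\<close>.\<close>
        show "\<forall>\<^sub>F n in sequentially. \<P>(X in P n. test_rejects S n N (ln n) X) \<le> 1"
          using P
        proof eventually_elim
          case (elim n)
          then obtain f \<epsilon> where f: "f \<in> Holder_slope \<alpha> \<beta> S" and \<epsilon>: "\<epsilon> \<in> {0..1}"
            and P_eq: "P n = iid_law n (mixture \<epsilon> uniform_square (uniform_graph f))"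
            by (auto simp: H1_def)
          interpret D: prob_space "mixture \<epsilon> uniform_square (uniform_graph f)"
            using sets_uniform_square prob_space_uniform_square prob_space_uniform_graph[OF f] f \<epsilon>
            by (intro prob_space_mixture) auto
          interpret PP: product_prob_space "\<lambda>_. mixture \<epsilon> uniform_square (uniform_graph f)" "{1..n}"
            by standard
          show ?case
            unfolding P_eq iid_law_def by (rule PP.prob_le_1)
        qed
      qed simp
    qed simp
  qed
  show ?thesis
    using power null by (intro exI[of _ "real N"] exI[of _ "\<lambda>n. ln (real n)"]) blast
qed

end
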